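(* Let $V$ be a unitary irreducible lowest weight representation of the open string algebra $\hat{G}_{\Lambda,\Lambda_F}$. Then $V$ is isomorphic to a tensor product $V_1\otimes V_2$ (each $X\in\hat{G}_{\Lambda,\Lambda_F}$ acting as $X\otimes1+1\otimes X$), where $V_1$ is a unitary irreducible lowest weight representation whose lowest weight is approximately finite, and $V_2$ is a unitary irreducible lowest weight representation on which every element of $sl(\infty)=[gl(\infty),gl(\infty)]$ acts as the zero operator.
   Context: Fix positive integers $\Lambda,\Lambda_F$. A sequence $\dot I=i_1\cdots i_a$ is a finite, possibly empty, sequence of integers in $\{1,\dots,\Lambda\}$; $\#(\dot I)=a$ is its length, $\emptyset$ is the empty sequence, juxtaposition denotes concatenation, and $\delta^{\dot I}_{\dot J}$ is $1$ if $\dot I=\dot J$ and $0$ otherwise (similarly for integers). Let $\mathcal{T}_o$ be the complex vector space with basis the symbols $\bar\phi^{\lambda_1}\otimes s^{\dot K}\otimes\phi^{\lambda_2}$, $1\le\lambda_1,\lambda_2\le\Lambda_F$, $\dot K$ any sequence. For all sequences $\dot I,\dot J$ and all $\lambda_i\in\{1,\dots,\Lambda_F\}$ define linear operators on $\mathcal{T}_o$ (each written as a single symbol): first kind: $\bar\Xi^{\lambda_1}_{\lambda_2}\otimes f^{\dot I}_{\dot J}\otimes\Xi^{\lambda_3}_{\lambda_4}(\bar\phi^{\lambda_5}\otimes s^{\dot K}\otimes\phi^{\lambda_6})=\delta^{\lambda_5}_{\lambda_2}\delta^{\dot K}_{\dot J}\delta^{\lambda_6}_{\lambda_4}\,\bar\phi^{\lambda_1}\otimes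 s^{\dot I}\otimes\phi^{\lambda_3}$; second kind: $\bar\Xi^{\lambda_1}_{\lambda_2}\otimes l^{\dot I}_{\dot J}(\bar\phi^{\lambda_3}\otimes s^{\dot K}\otimes\phi^{\lambda_4})=\delta^{\lambda_3}_{\lambda_2}\sum_{\dot K_1\dot K_2=\dot K}\delta^{\dot K_1}_{\dot J}\,\bar\phi^{\lambda_1}\otimes s^{\dot I\dot K_2}\otimes\phi^{\lambda_4}$; third kind: $r^{\dot I}_{\dot J}\otimes\Xi^{\lambda_1}_{\lambda_2}(\bar\phi^{\lambda_3}\otimes s^{\dot K}\otimes\phi^{\lambda_4})=\delta^{\lambda_4}_{\lambda_2}\sum_{\dot K_1\dot K_2=\dot K}\delta^{\dot K_2}_{\dot J}\,\bar\phi^{\lambda_3}\otimes s^{\dot K_1\dot I}\otimes\phi^{\lambda_1}$; fourth kind: $\sigma^{\dot I}_{\dot J}(\bar\phi^{\lambda_1}\otimes s^{\dot K}\otimes\phi^{\lambda_2})=\sum_{\dot K_1\dot K_2\dot K_3=\dot K}\delta^{\dot K_2}_{\dot J}\,\bar\phi^{\lambda_1}\otimes s^{\dot K_1\dot I\dot K_3}\otimes\phi^{\lambda_2}$; sums run over all ways to write $\dot K$ as a concatenation of possibly empty sequences. The open string algebra $\hat{G}_{\Lambda,\Lambda_F}$ is the complex Lie algebra (commutator bracket) of operators on $\mathcal{T}_o$ spanned by all operators of these four kinds. Let $gl(\infty)$ be the span of the first-kind operators. Ordering: for finite sequences of positive integers $a=a_1\cdots a_m$, $b=b_1\cdots b_n$,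 $a>b$ means $m>n$, or $m=n\ne0$ and $a_r>b_r$ at the first index $r$ where they differ; it is applied to concatenations such as $\dot I\lambda_1\lambda_3$. Let $G^{00}$ be the span of all $\bar\Xi^{\lambda_1}_{\lambda_1}\otimes f^{\dot I}_{\dot I}\otimes\Xi^{\lambda_2}_{\lambda_2}$, $\bar\Xi^{\lambda}_{\lambda}\otimes l^{\dot I}_{\dot I}$, $r^{\dot I}_{\dot I}\otimes\Xi^{\lambda}_{\lambda}$, $\sigma^{\dot I}_{\dot I}$. Let $G^-$ be the span of all operators of the four kinds with $\#(\dot I)<\#(\dot J)$, together with those with $\#(\dot I)=\#(\dot J)$ and $\dot J\lambda_2\lambda_4>\dot I\lambda_1\lambda_3$ (first kind), $\dot J\lambda_2>\dot I\lambda_1$ (second and third kind), $\dot J>\dot I$ (fourth kind); $G^+$ is defined with all inequalities reversed. Then $\hat{G}_{\Lambda,\Lambda_F}=G^+\oplus G^{00}\oplus G^-$. Let $\omega$ be the antilinear anti-involution with $\omega(\bar\Xi^{\lambda_1}_{\lambda_2}\otimes f^{\dot I}_{\dot J}\otimes\Xi^{\lambda_3}_{\lambda_4})=\bar\Xi^{\lambda_2}_{\lambda_1}\otimes f^{\dot J}_{\dot I}\otimes\Xi^{\lambda_4}_{\lambda_3}$, $\omega(\bar\Xi^{\lambda_1}_{\lambda_2}\otimes l^{\dot I}_{\dot J})=\bar\Xi^{\lambda_2}_{\lambda_1}\otimes l^{\dot J}_{\dot I}$, $\omega(r^{\dot I}_{\dot J}\otimes\Xi^{\lambda_1}_{\lambda_2})=r^{\dot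 J}_{\dot I}\otimes\Xi^{\lambda_2}_{\lambda_1}$, $\omega(\sigma^{\dot I}_{\dot J})=\sigma^{\dot J}_{\dot I}$, extended to the universal enveloping algebra as antilinear anti-automorphism. A lowest weight $h$ is a linear functional on $G^{00}$ real on the spanning operators; write $h_I(\lambda_1;\dot I;\lambda_2)$, $h_{II}(\lambda;\dot I)$, $h_{III}(\dot I;\lambda)$, $h_{IV}(\dot I)$ for its values on $\bar\Xi^{\lambda_1}_{\lambda_1}\otimes f^{\dot I}_{\dot I}\otimes\Xi^{\lambda_2}_{\lambda_2}$, $\bar\Xi^{\lambda}_{\lambda}\otimes l^{\dot I}_{\dot I}$, $r^{\dot I}_{\dot I}\otimes\Xi^{\lambda}_{\lambda}$, $\sigma^{\dot I}_{\dot I}$. A lowest weight representation with lowest weight $h$ is a representation generated by a vector $v\ne0$ with $G^-v=0$ and $Hv=h(H)v$ for $H\in G^{00}$; it is unitary if it carries a positive definite Hermitian form with $\langle Xu,w\rangle=\langle u,\omega(X)w\rangle$ for all $X$. $h$ is approximately finite if: (i) $h_I(\lambda_1;\dot I;\lambda_2)-h_I(\lambda_3;\dot J;\lambda_4)$ is a non-negative integer whenever $\dot J\lambda_3\lambda_4>\dot I\lambda_1\lambda_2$; (ii) $h_{II}(\lambda;\dot I)=\sum_{\dot I_1,\lambda_1}h_I(\lambda;\dot I\dot I_1;\lambda_1)$; (iii) $h_{III}(\dot I;\lambda)=\sum_{\lambda_1,\dot I_1}h_I(\lambda_1;\dot I_1\dot I;\lambda)$; (iv) $h_{IV}(\dot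 I)=\sum_{\lambda_1,\dot I_1,\dot I_2,\lambda_2}h_I(\lambda_1;\dot I_1\dot I\dot I_2;\lambda_2)$; sums over all (possibly empty) sequences and all $\lambda_i\in\{1,\dots,\Lambda_F\}$, each having only finitely many non-zero terms. *)

theory Defs
  imports Complex_Main
begin

definition valid_seq :: "nat \<Rightarrow> nat list \<Rightarrow> bool" where
  "valid_seq L I \<longleftrightarrow> set I \<subseteq> {1..L}"

definition valid_lam :: "nat \<Rightarrow> nat \<Rightarrow> bool" where
  "valid_lam LF l \<longleftrightarrow> l \<in> {1..LF}"

(* basis symbols  phibar^a (x) s^K (x) phi^b  of T_o are encoded as triples (a, K, b) *)
type_synonym tbasis = "nat \<times> nat list \<times> nat"

definition basis_ok :: "nat \<Rightarrow> nat \<Rightarrow> tbasis \<Rightarrow> bool" where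
  "basis_ok L LF x \<longleftrightarrow> (case x of (a, K, b) \<Rightarrow> valid_lam LF a \<and> valid_seq L K \<and> valid_lam LF b)"

(* A linear operator on T_o is encoded by its matrix: M x y = coefficient of the
   basis vector y in M(x).  Entries with x outside the basis are 0. *)
type_synonym opm = "tbasis \<Rightarrow> tbasis \<Rightarrow> complex"

datatype gen =
    Gf nat nat "nat list" "nat list" nat nat   (* Xibar^{l1}_{l2} (x) f^I_J (x) Xi^{l3}_{l4}:  Gf l1 l2 I J l3 l4 *)
  | Gl nat nat "nat list" "nat list"           (* Xibar^{l1}_{l2} (x) l^I_J :  Gl l1 l2 I J *)
  | Gr "nat list" "nat list" nat nat           (* r^I_J (x) Xi^{l1}_{l2} :  Gr I J l1 l2 *)
  | Gs "nat list" "nat list"                   (* sigma^I_J :  Gs I J *)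

fun valid_gen :: "nat \<Rightarrow> nat \<Rightarrow> gen \<Rightarrow> bool" where
  "valid_gen L LF (Gf l1 l2 I J l3 l4) \<longleftrightarrow> valid_lam LF l1 \<and> valid_lam LF l2 \<and> valid_seq L I \<and>
      valid_seq L J \<and> valid_lam LF l3 \<and> valid_lam LF l4"
| "valid_gen L LF (Gl l1 l2 I J) \<longleftrightarrow> valid_lam LF l1 \<and> valid_lam LF l2 \<and> valid_seq L I \<and> valid_seq L J"
| "valid_gen L LF (Gr I J l1 l2) \<longleftrightarrow> valid_seq L I \<and> valid_seq L J \<and> valid_lam LF l1 \<and> valid_lam LF l2"
| "valid_gen L LF (Gs I J) \<longleftrightarrow> valid_seq L I \<and> valid_seq L J"

(* The action of the four kinds of operators on basis vectors.  Decompositions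
   K = K1 K2 are indexed by n = length K1, decompositions K = K1 K2 K3 by
   (i, j) with K1 = take i K, K2 = take (j - i) (drop i K), K3 = drop j K. *)
fun opm_of :: "nat \<Rightarrow> nat \<Rightarrow> gen \<Rightarrow> opm" where
  "opm_of L LF (Gf l1 l2 I J l3 l4) (a, K, b) y =
     (if basis_ok L LF (a, K, b) \<and> a = l2 \<and> K = J \<and> b = l4 \<and> y = (l1, I, l3) then 1 else 0)"
| "opm_of L LF (Gl l1 l2 I J) (a, K, b) y =
     (if basis_ok L LF (a, K, b) \<and> a = l2 then
        (\<Sum>n\<in>{0..length K}. if take n K = J \<and> y = (l1, I @ drop n K, b) then 1 else 0)
      else 0)"
| "opm_of L LF (Gr I J l1 l2) (a, K, b) y =
     (if basis_ok L LF (a, K, b) \<and> b = l2 then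
        (\<Sum>n\<in>{0..length K}. if drop n K = J \<and> y = (a, take n K @ I, l1) then 1 else 0)
      else 0)"
| "opm_of L LF (Gs I J) (a, K, b) y =
     (if basis_ok L LF (a, K, b) then
        (\<Sum>(i, j)\<in>{(i, j). i \<le> j \<and> j \<le> length K}.
            if take (j - i) (drop i K) = J \<and> y = (a, take i K @ I @ drop j K, b) then 1 else 0)
      else 0)"

fun omega_gen :: "gen \<Rightarrow> gen" where
  "omega_gen (Gf l1 l2 I J l3 l4) = Gf l2 l1 J I l4 l3"
| "omega_gen (Gl l1 l2 I J) = Gl l2 l1 J I"
| "omega_gen (Gr I J l1 l2) = Gr J I l2 l1"
| "omega_gen (Gs I J) = Gs J I"

definition opcomp :: "opm \<Rightarrow> opm \<Rightarrow> opm" where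
  "opcomp M N = (\<lambda>x z. \<Sum>y\<in>{y. N x y \<noteq> 0}. N x y * M y z)"

definition opcomm :: "opm \<Rightarrow> opm \<Rightarrow> opm" where
  "opcomm M N = (\<lambda>x z. opcomp M N x z - opcomp N M x z)"

definition oplin :: "complex \<Rightarrow> opm \<Rightarrow> complex \<Rightarrow> opm \<Rightarrow> opm" where
  "oplin a M b N = (\<lambda>x y. a * M x y + b * N x y)"

definition opspan :: "opm set \<Rightarrow> opm set" where
  "opspan S = {M. \<exists>T c. finite T \<and> T \<subseteq> S \<and> M = (\<lambda>x y. \<Sum>g\<in>T. c g * g x y)}"

definition Ghat :: "nat \<Rightarrow> nat \<Rightarrow> opm set" where
  "Ghat L LF = opspan (opm_of L LF ` {g. valid_gen L LF g})"

fun is_first_kind :: "gen \<Rightarrow> bool" where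
  "is_first_kind (Gf _ _ _ _ _ _) = True"
| "is_first_kind _ = False"

definition gl_inf :: "nat \<Rightarrow> nat \<Rightarrow> opm set" where
  "gl_inf L LF = opspan (opm_of L LF ` {g. valid_gen L LF g \<and> is_first_kind g})"

definition sl_inf :: "nat \<Rightarrow> nat \<Rightarrow> opm set" where
  "sl_inf L LF = opspan {opcomm A B | A B. A \<in> gl_inf L LF \<and> B \<in> gl_inf L LF}"

definition seq_gt :: "nat list \<Rightarrow> nat list \<Rightarrow> bool" where
  "seq_gt a b \<longleftrightarrow> length a > length b \<or>
     (length a = length b \<and> a \<noteq> [] \<and>
        (\<exists>r < length a. take r a = take r b \<and> a ! r > b ! r))"

fun neg_gen :: "gen \<Rightarrow> bool" where
  "neg_gen (Gf l1 l2 I J l3 l4) \<longleftrightarrow> length I < length J \<or>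
      (length I = length J \<and> seq_gt (J @ [l2, l4]) (I @ [l1, l3]))"
| "neg_gen (Gl l1 l2 I J) \<longleftrightarrow> length I < length J \<or>
      (length I = length J \<and> seq_gt (J @ [l2]) (I @ [l1]))"
| "neg_gen (Gr I J l1 l2) \<longleftrightarrow> length I < length J \<or>
      (length I = length J \<and> seq_gt (J @ [l2]) (I @ [l1]))"
| "neg_gen (Gs I J) \<longleftrightarrow> length I < length J \<or>
      (length I = length J \<and> seq_gt J I)"

fun diag_gen :: "gen \<Rightarrow> bool" where
  "diag_gen (Gf l1 l2 I J l3 l4) \<longleftrightarrow> l1 = l2 \<and> I = J \<and> l3 = l4"
| "diag_gen (Gl l1 l2 I J) \<longleftrightarrow> l1 = l2 \<and> I = J"
| "diag_gen (Gr I J l1 l2) \<longleftrightarrow> I = J \<and> l1 = l2"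
| "diag_gen (Gs I J) \<longleftrightarrow> I = J"

definition Gminus :: "nat \<Rightarrow> nat \<Rightarrow> opm set" where
  "Gminus L LF = opspan (opm_of L LF ` {g. valid_gen L LF g \<and> neg_gen g})"

definition G00 :: "nat \<Rightarrow> nat \<Rightarrow> opm set" where
  "G00 L LF = opspan (opm_of L LF ` {g. valid_gen L LF g \<and> diag_gen g})"

definition is_rep :: "nat \<Rightarrow> nat \<Rightarrow> (complex \<Rightarrow> 'v::ab_group_add \<Rightarrow> 'v) \<Rightarrow> (opm \<Rightarrow> 'v \<Rightarrow> 'v) \<Rightarrow> 'v set \<Rightarrow> bool" where
  "is_rep L LF scale rho W \<longleftrightarrow>
     module.subspace scale W \<and>
     (\<forall>X\<in>Ghat L LF. \<forall>u\<in>W. rho X u \<in> W) \<and>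
     (\<forall>X\<in>Ghat L LF. \<forall>u\<in>W. \<forall>u'\<in>W. \<forall>a b.
         rho X (scale a u + scale b u') = scale a (rho X u) + scale b (rho X u')) \<and>
     (\<forall>X\<in>Ghat L LF. \<forall>Y\<in>Ghat L LF. \<forall>a b. \<forall>u\<in>W.
         rho (oplin a X b Y) u = scale a (rho X u) + scale b (rho Y u)) \<and>
     (\<forall>X\<in>Ghat L LF. \<forall>Y\<in>Ghat L LF. \<forall>u\<in>W.
         rho (opcomm X Y) u = rho X (rho Y u) - rho Y (rho X u))"

definition invariant_subspace :: "nat \<Rightarrow> nat \<Rightarrow> (complex \<Rightarrow> 'v::ab_group_add \<Rightarrow> 'v) \<Rightarrow> (opm \<Rightarrow> 'v \<Rightarrow> 'v) \<Rightarrow> 'v set \<Rightarrow> bool" where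
  "invariant_subspace L LF scale rho U \<longleftrightarrow>
     module.subspace scale U \<and> (\<forall>X\<in>Ghat L LF. \<forall>u\<in>U. rho X u \<in> U)"

definition irreducible_rep :: "nat \<Rightarrow> nat \<Rightarrow> (complex \<Rightarrow> 'v::ab_group_add \<Rightarrow> 'v) \<Rightarrow> (opm \<Rightarrow> 'v \<Rightarrow> 'v) \<Rightarrow> 'v set \<Rightarrow> bool" where
  "irreducible_rep L LF scale rho W \<longleftrightarrow>
     W \<noteq> {0} \<and>
     (\<forall>U. U \<subseteq> W \<and> invariant_subspace L LF scale rho U \<longrightarrow> U = {0} \<or> U = W)"

(* unitarity: a positive definite Hermitian form (linear in the first, antilinear in
   the second argument) with <X u, w> = <u, omega(X) w> for the spanning operators X
   (this extends to all of \<hat>G and its enveloping algebra by (anti)linearity) *)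
definition unitary_rep :: "nat \<Rightarrow> nat \<Rightarrow> (complex \<Rightarrow> 'v::ab_group_add \<Rightarrow> 'v) \<Rightarrow> (opm \<Rightarrow> 'v \<Rightarrow> 'v) \<Rightarrow> 'v set \<Rightarrow> bool" where
  "unitary_rep L LF scale rho W \<longleftrightarrow>
     (\<exists>form :: 'v \<Rightarrow> 'v \<Rightarrow> complex.
        (\<forall>u\<in>W. \<forall>u'\<in>W. \<forall>w\<in>W. \<forall>a b.
            form (scale a u + scale b u') w = a * form u w + b * form u' w) \<and>
        (\<forall>u\<in>W. \<forall>w\<in>W. form w u = cnj (form u w)) \<and>
        (\<forall>u\<in>W. u \<noteq> 0 \<longrightarrow> Re (form u u) > 0) \<and>
        (\<forall>g. valid_gen L LF g \<longrightarrow> (\<forall>u\<in>W. \<forall>w\<in>W.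
            form (rho (opm_of L LF g) u) w = form u (rho (opm_of L LF (omega_gen g)) w))))"

definition lowest_weight_functional :: "nat \<Rightarrow> nat \<Rightarrow> (opm \<Rightarrow> complex) \<Rightarrow> bool" where
  "lowest_weight_functional L LF h \<longleftrightarrow>
     (\<forall>H\<in>G00 L LF. \<forall>K\<in>G00 L LF. \<forall>a b. h (oplin a H b K) = a * h H + b * h K) \<and>
     (\<forall>g. valid_gen L LF g \<and> diag_gen g \<longrightarrow> h (opm_of L LF g) \<in> \<real>)"

definition lowest_weight_rep :: "nat \<Rightarrow> nat \<Rightarrow> (complex \<Rightarrow> 'v::ab_group_add \<Rightarrow> 'v) \<Rightarrow> (opm \<Rightarrow> 'v \<Rightarrow> 'v) \<Rightarrow> 'v set
     \<Rightarrow> (opm \<Rightarrow> complex) \<Rightarrow> 'v \<Rightarrow> bool" where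
  "lowest_weight_rep L LF scale rho W h v \<longleftrightarrow>
     lowest_weight_functional L LF h \<and>
     v \<in> W \<and> v \<noteq> 0 \<and>
     (\<forall>U. U \<subseteq> W \<and> v \<in> U \<and> invariant_subspace L LF scale rho U \<longrightarrow> U = W) \<and>
     (\<forall>X\<in>Gminus L LF. rho X v = 0) \<and>
     (\<forall>H\<in>G00 L LF. rho H v = scale (h H) v)"

definition hI :: "nat \<Rightarrow> nat \<Rightarrow> (opm \<Rightarrow> complex) \<Rightarrow> nat \<Rightarrow> nat list \<Rightarrow> nat \<Rightarrow> complex" where
  "hI L LF h l1 I l2 = h (opm_of L LF (Gf l1 l1 I I l2 l2))"

definition hII :: "nat \<Rightarrow> nat \<Rightarrow> (opm \<Rightarrow> complex) \<Rightarrow> nat \<Rightarrow> nat list \<Rightarrow> complex" where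
  "hII L LF h l I = h (opm_of L LF (Gl l l I I))"

definition hIII :: "nat \<Rightarrow> nat \<Rightarrow> (opm \<Rightarrow> complex) \<Rightarrow> nat list \<Rightarrow> nat \<Rightarrow> complex" where
  "hIII L LF h I l = h (opm_of L LF (Gr I I l l))"

definition hIV :: "nat \<Rightarrow> nat \<Rightarrow> (opm \<Rightarrow> complex) \<Rightarrow> nat list \<Rightarrow> complex" where
  "hIV L LF h I = h (opm_of L LF (Gs I I))"

(* approximately finite lowest weights; each infinite sum is required to have only
   finitely many non-zero terms and is then the finite sum over those terms *)
definition approx_finite :: "nat \<Rightarrow> nat \<Rightarrow> (opm \<Rightarrow> complex) \<Rightarrow> bool" where
  "approx_finite L LF h \<longleftrightarrow>
     (\<forall>l1 l2 l3 l4 I J. valid_lam LF l1 \<and> valid_lam LF l2 \<and> valid_lam LF l3 \<and> valid_lam LF l4 \<and>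
         valid_seq L I \<and> valid_seq L J \<and> seq_gt (J @ [l3, l4]) (I @ [l1, l2]) \<longrightarrow>
         (\<exists>n::nat. hI L LF h l1 I l2 - hI L LF h l3 J l4 = of_nat n)) \<and>
     (\<forall>l I. valid_lam LF l \<and> valid_seq L I \<longrightarrow>
        (let S = {(I1, l1). valid_seq L I1 \<and> valid_lam LF l1 \<and> hI L LF h l (I @ I1) l1 \<noteq> 0}
         in finite S \<and> hII L LF h l I = (\<Sum>(I1, l1)\<in>S. hI L LF h l (I @ I1) l1))) \<and>
     (\<forall>I l. valid_seq L I \<and> valid_lam LF l \<longrightarrow>
        (let S = {(l1, I1). valid_lam LF l1 \<and> valid_seq L I1 \<and> hI L LF h l1 (I1 @ I) l \<noteq> 0}
         in finite S \<and> hIII L LF h I l = (\<Sum>(l1, I1)\<in>S. hI L LF h l1 (I1 @ I) l))) \<and>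
     (\<forall>I. valid_seq L I \<longrightarrow>
        (let S = {(l1, I1, I2, l2). valid_lam LF l1 \<and> valid_seq L I1 \<and> valid_seq L I2 \<and> valid_lam LF l2 \<and>
                    hI L LF h l1 (I1 @ I @ I2) l2 \<noteq> 0}
         in finite S \<and> hIV L LF h I = (\<Sum>(l1, I1, I2, l2)\<in>S. hI L LF h l1 (I1 @ I @ I2) l2)))"

(* The complex vector space V = UNIV::'v (with action rho) is isomorphic, as a
   representation, to V1 (x) V2 (action X (x) 1 + 1 (x) X), where V1 = W1 with
   action rho1 and V2 = W2 with action rho2, via the bilinear map tau: tau is
   bilinear on W1 x W2, its image spans V, and the induced map V1 (x) V2 -> V is
   injective (sum_i tau(x_i, y_i) = 0 with x_i linearly independent forces all
   y_i = 0), i.e. (V, tau) is a tensor product of W1 and W2; moreover tau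
   intertwines the actions. *)
definition tensor_iso :: "nat \<Rightarrow> nat \<Rightarrow> (complex \<Rightarrow> 'v::ab_group_add \<Rightarrow> 'v) \<Rightarrow> (opm \<Rightarrow> 'v \<Rightarrow> 'v)
    \<Rightarrow> 'v set \<Rightarrow> (opm \<Rightarrow> 'v \<Rightarrow> 'v) \<Rightarrow> 'v set \<Rightarrow> (opm \<Rightarrow> 'v \<Rightarrow> 'v) \<Rightarrow> ('v \<Rightarrow> 'v \<Rightarrow> 'v) \<Rightarrow> bool" where
  "tensor_iso L LF scale rho W1 rho1 W2 rho2 tau \<longleftrightarrow>
     (\<forall>x\<in>W1. \<forall>x'\<in>W1. \<forall>y\<in>W2. \<forall>a b.
         tau (scale a x + scale b x') y = scale a (tau x y) + scale b (tau x' y)) \<and>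
     (\<forall>x\<in>W1. \<forall>y\<in>W2. \<forall>y'\<in>W2. \<forall>a b.
         tau x (scale a y + scale b y') = scale a (tau x y) + scale b (tau x y')) \<and>
     module.span scale {tau x y | x y. x \<in> W1 \<and> y \<in> W2} = UNIV \<and>
     (\<forall>S f. finite S \<and> S \<subseteq> W1 \<and> \<not> module.dependent scale S \<and> f ` S \<subseteq> W2 \<and>
         (\<Sum>x\<in>S. tau x (f x)) = 0 \<longrightarrow> (\<forall>x\<in>S. f x = 0)) \<and>
     (\<forall>X\<in>Ghat L LF. \<forall>x\<in>W1. \<forall>y\<in>W2. rho X (tau x y) = tau (rho1 X x) y + tau x (rho2 X y))"

end

theory Submission
  imports Defs
begin

text \<open>
  The first-kind operators span the finitary matrices on the ordered basis of \<open>T_o\<close>. Unitarity makes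
  the lowest weight non-increasing along the basis with integral steps (an \<open>sl\<^sub>2\<close> argument), and
  Bessel's inequality for the image of the lowest weight vector under the shift
  \<open>l\<^sup>1\<^sub>\<emptyset>\<close> makes it eventually constant, say equal to \<open>c\<close>.

  Let \<open>E A = \<rho>(A) - c tr A\<close> for finitary \<open>A\<close>. On every vector almost all \<open>E\<close> of matrix units whose
  column is far out vanish, so \<open>D X = \<Sum>X\<^sub>y\<^sub>x E\<^sub>y\<^sub>x\<close> makes sense for all \<open>X\<close> in the algebra. Both \<open>D\<close> and
  \<open>R = \<rho> - D\<close> are representations, they commute, and \<open>R\<close> kills \<open>sl(\<infinity>)\<close>. The two factors are the
  \<open>D\<close>- and the \<open>R\<close>-submodule generated by the lowest weight vector; the Hermitian form factorises
  along them, which gives injectivity of \<open>V\<^sub>1 \<otimes> V\<^sub>2 \<rightarrow> V\<close> and, by partial projection, irreducibility of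
  both factors.
\<close>

subsection \<open>Matrices on the basis\<close>

text \<open>Matrix entries are read input first: \<open>M x y\<close> is the passage from
  \<open>x\<close> to \<open>y\<close>, so "column x" means the input \<open>x\<close>. The obstacle
  is that a general \<open>X\<close> in the algebra is an infinite combination of matrix units.
  Applied to \<open>v\<close>, the unshifted sum has infinitely many diagonal terms far out, each
  acting by \<open>c\<close>; subtracting \<open>c\<close> times the trace removes exactly this
  tail. It does no harm to brackets, because a bracket of a finitary matrix with any element of the
  algebra has trace 0. Far-out raising units vanish on \<open>v\<close> because their squared norm
  is a weight difference, which is 0 there. \<open>rho X\<close> and \<open>D X\<close> have the
  same bracket with every \<open>E A\<close>, which is why their difference \<open>R X\<close>
  commutes with \<open>E A\<close>. On finitary \<open>A\<close> one gets
  \<open>R A = c tr A\<close>, hence 0 on traceless matrices. The lowest weight of \<open>D\<close>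
  is the sum of \<open>X x x * (wt x - c)\<close>; approximate finiteness holds because the diagonal
  entries of the \<open>l\<close>, \<open>r\<close>, \<open>sigma\<close> operators count
  factorisations of words. The space is only pre-Hilbert, so orthogonal projections onto the factors
  are replaced by explicit formulas on the vectors \<open>tau x y\<close>.\<close>

definition unit_mat :: "tbasis \<Rightarrow> tbasis \<Rightarrow> opm" where
  "unit_mat x y = (\<lambda>a b. if a = x \<and> b = y then 1 else 0)"

text \<open>The generator lists target labels before source labels, opposite to the input-first
  order of \<open>opm\<close>; hence the primed labels of the second argument come first.\<close>

fun unit_gen :: "tbasis \<Rightarrow> tbasis \<Rightarrow> gen" where
  "unit_gen (a, I, b) (a', I', b') = Gf a' a I' I b' b"

definition fin_mat :: "nat \<Rightarrow> nat \<Rightarrow> opm \<Rightarrow> bool" where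
  "fin_mat L LF A \<longleftrightarrow> (\<exists>F. finite F \<and> (\<forall>x\<in>F. basis_ok L LF x) \<and> (\<forall>x y. A x y \<noteq> 0 \<longrightarrow> x \<in> F \<and> y \<in> F))"

text \<open>Finitely many outputs per input make compositions finite sums. Finitely many inputs per
  output are what keeps \<open>opcomp A X\<close> finitary for finitary \<open>A\<close>.\<close>

definition rc_mat :: "nat \<Rightarrow> nat \<Rightarrow> opm \<Rightarrow> bool" where
  "rc_mat L LF X \<longleftrightarrow> (\<forall>x. finite {y. X x y \<noteq> 0}) \<and> (\<forall>y. finite {x. X x y \<noteq> 0}) \<and>
     (\<forall>x y. X x y \<noteq> 0 \<longrightarrow> basis_ok L LF x \<and> basis_ok L LF y)"

definition mrestr :: "opm \<Rightarrow> tbasis set \<Rightarrow> opm" where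
  "mrestr X F = (\<lambda>x y. if x \<in> F then X x y else 0)"

text \<open>A total function: the trace when the diagonal has finite support, and 0 by the
  convention for infinite sums otherwise.\<close>

definition mtrace :: "opm \<Rightarrow> complex" where
  "mtrace A = (\<Sum>x\<in>{x. A x x \<noteq> 0}. A x x)"

definition madj :: "opm \<Rightarrow> opm" where
  "madj A = (\<lambda>x y. cnj (A y x))"

lemma opm_of_unit_gen: "basis_ok L LF x \<Longrightarrow> opm_of L LF (unit_gen x y) = unit_mat x y"
  by (cases x; cases y) (auto simp: unit_mat_def fun_eq_iff)

lemma valid_unit_gen: "basis_ok L LF x \<Longrightarrow> basis_ok L LF y \<Longrightarrow> valid_gen L LF (unit_gen x y)"
  by (cases x; cases y) (auto simp: basis_ok_def)

lemma omega_unit_gen: "omega_gen (unit_gen x y) = unit_gen y x"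
  by (cases x; cases y) auto

lemma fin_matE:
  assumes "fin_mat L LF A"
  obtains F where "finite F" "\<And>x. x \<in> F \<Longrightarrow> basis_ok L LF x" "\<And>x y. A x y \<noteq> 0 \<Longrightarrow> x \<in> F" "\<And>x y. A x y \<noteq> 0 \<Longrightarrow> y \<in> F"
  using assms unfolding fin_mat_def by blast

lemma fin_matI:
  assumes "finite {(x, y). A x y \<noteq> 0}" "\<And>x y. A x y \<noteq> 0 \<Longrightarrow> basis_ok L LF x \<and> basis_ok L LF y"
  shows "fin_mat L LF A"
  unfolding fin_mat_def
proof (intro exI conjI)
  let ?P = "{(x, y). A x y \<noteq> 0}"
  show "finite (fst ` ?P \<union> snd ` ?P)" using assms(1) by simp
  show "\<forall>x\<in>fst ` ?P \<union> snd ` ?P. basis_ok L LF x" using assms(2) by auto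
  show "\<forall>x y. A x y \<noteq> 0 \<longrightarrow> x \<in> fst ` ?P \<union> snd ` ?P \<and> y \<in> fst ` ?P \<union> snd ` ?P"
    by force
qed

lemma fin_mat_ok: "fin_mat L LF A \<Longrightarrow> A x y \<noteq> 0 \<Longrightarrow> basis_ok L LF x \<and> basis_ok L LF y"
  unfolding fin_mat_def by blast

lemma fin_mat_finite: "fin_mat L LF A \<Longrightarrow> finite {(x, y). A x y \<noteq> 0}"
proof -
  assume "fin_mat L LF A"
  then obtain F where F: "finite F" "\<And>x y. A x y \<noteq> 0 \<Longrightarrow> x \<in> F" "\<And>x y. A x y \<noteq> 0 \<Longrightarrow> y \<in> F"
    by (metis fin_matE)
  have "{(x, y). A x y \<noteq> 0} \<subseteq> F \<times> F" using F(2,3) by auto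
  then show ?thesis using F(1) finite_subset by blast
qed

lemma fin_mat_zero: "fin_mat L LF (\<lambda>x y. 0)"
  by (rule fin_matI) auto

lemma fin_mat_unit: "basis_ok L LF x \<Longrightarrow> basis_ok L LF y \<Longrightarrow> fin_mat L LF (unit_mat x y)"
  unfolding fin_mat_def by (rule exI[of _ "{x, y}"]) (auto simp: unit_mat_def)

lemma fin_mat_oplin:
  assumes "fin_mat L LF A" "fin_mat L LF B"
  shows "fin_mat L LF (oplin a A b B)"
proof (rule fin_matI)
  have "{(x, y). oplin a A b B x y \<noteq> 0} \<subseteq> {(x, y). A x y \<noteq> 0} \<union> {(x, y). B x y \<noteq> 0}"
    by (auto simp: oplin_def)
  then show "finite {(x, y). oplin a A b B x y \<noteq> 0}"
    using fin_mat_finite assms by (meson finite_UnI finite_subset)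
  fix x y assume "oplin a A b B x y \<noteq> 0"
  then have "A x y \<noteq> 0 \<or> B x y \<noteq> 0" by (auto simp: oplin_def)
  then show "basis_ok L LF x \<and> basis_ok L LF y" using fin_mat_ok assms by blast
qed

lemma fin_mat_madj: "fin_mat L LF A \<Longrightarrow> fin_mat L LF (madj A)"
  unfolding fin_mat_def madj_def by auto

text \<open>The unit case remembers \<open>A x y \<noteq> 0\<close>, so that a support condition on
  \<open>A\<close> (vanishing inputs, lowering, diagonal) is available for each matrix unit that
  occurs.\<close>

lemma fin_mat_induct [consumes 1, case_names zero unit oplin]:
  assumes fin: "fin_mat L LF A"
    and zero: "P (\<lambda>x y. 0)"
    and unit: "\<And>x y. A x y \<noteq> 0 \<Longrightarrow> basis_ok L LF x \<Longrightarrow> basis_ok L LF y \<Longrightarrow> P (unit_mat x y)"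
    and lin: "\<And>a b B C. fin_mat L LF B \<Longrightarrow> fin_mat L LF C \<Longrightarrow> P B \<Longrightarrow> P C \<Longrightarrow> P (oplin a B b C)"
  shows "P A"
proof -
  let ?P = "{(x, y). A x y \<noteq> 0}"
  have main: "fin_mat L LF (\<lambda>x y. if (x, y) \<in> Q then A x y else 0) \<and> P (\<lambda>x y. if (x, y) \<in> Q then A x y else 0)"
    if "finite Q" "Q \<subseteq> ?P" for Q
    using that
  proof (induction Q rule: finite_induct)
    case empty
    then show ?case using zero fin_mat_zero by simp
  next
    case (insert p Q)
    obtain x y where p: "p = (x, y)" by (cases p)
    have Axy: "A x y \<noteq> 0" using insert p by auto
    have ok: "basis_ok L LF x" "basis_ok L LF y" using fin_mat_ok[OF fin Axy] by auto
    let ?B = "\<lambda>x y. if (x, y) \<in> Q then A x y else 0"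
    have eq: "(\<lambda>x y. if (x, y) \<in> insert p Q then A x y else 0) = oplin 1 ?B (A x y) (unit_mat x y)"
      using insert(2) unfolding oplin_def unit_mat_def p by (auto simp: fun_eq_iff)
    have "fin_mat L LF ?B" "P ?B" using insert by auto
    then show ?case unfolding eq
      using lin[of ?B "unit_mat x y"] unit[OF Axy ok] fin_mat_unit[OF ok] fin_mat_oplin by blast
  qed
  have "(\<lambda>x y. if (x, y) \<in> ?P then A x y else 0) = A" by (auto simp: fun_eq_iff)
  then show ?thesis using main[OF fin_mat_finite[OF fin]] by simp
qed

lemma mtrace_eq_sum:
  assumes "finite G" "\<And>x. A x x \<noteq> 0 \<Longrightarrow> x \<in> G"
  shows "mtrace A = (\<Sum>x\<in>G. A x x)"
  unfolding mtrace_def using assms by (intro sum.mono_neutral_left) auto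

lemma mtrace_unit: "mtrace (unit_mat x y) = (if x = y then 1 else 0)"
  by (subst mtrace_eq_sum[of "{x}"]) (auto simp: unit_mat_def split: if_splits)

lemma mtrace_oplin:
  assumes "fin_mat L LF A" "fin_mat L LF B"
  shows "mtrace (oplin a A b B) = a * mtrace A + b * mtrace B"
proof -
  obtain F G where F: "finite F" "\<And>x y. A x y \<noteq> 0 \<Longrightarrow> x \<in> F" and G: "finite G" "\<And>x y. B x y \<noteq> 0 \<Longrightarrow> x \<in> G"
    using assms by (metis fin_matE)
  have "mtrace (oplin a A b B) = (\<Sum>x\<in>F \<union> G. oplin a A b B x x)"
  proof (rule mtrace_eq_sum)
    show "finite (F \<union> G)" using F G by simp
    show "x \<in> F \<union> G" if "oplin a A b B x x \<noteq> 0" for x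
    proof -
      have "A x x \<noteq> 0 \<or> B x x \<noteq> 0" using that by (metis oplin_def add.right_neutral mult_zero_right)
      then show ?thesis using F(2) G(2) by blast
    qed
  qed
  moreover have "mtrace A = (\<Sum>x\<in>F \<union> G. A x x)" "mtrace B = (\<Sum>x\<in>F \<union> G. B x x)"
    by (rule mtrace_eq_sum; use F G in blast)+
  ultimately show ?thesis by (simp add: oplin_def sum.distrib sum_distrib_left)
qed

lemma rc_mat_fin: "fin_mat L LF A \<Longrightarrow> rc_mat L LF A"
proof -
  assume A: "fin_mat L LF A"
  then obtain F where F: "finite F" "\<And>x. x \<in> F \<Longrightarrow> basis_ok L LF x"
     "\<And>x y. A x y \<noteq> 0 \<Longrightarrow> x \<in> F" "\<And>x y. A x y \<noteq> 0 \<Longrightarrow> y \<in> F"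
    by (metis fin_matE)
  have "finite {y. A x y \<noteq> 0}" for x by (rule finite_subset[OF _ F(1)]) (use F in blast)
  moreover have "finite {x. A x y \<noteq> 0}" for y by (rule finite_subset[OF _ F(1)]) (use F in blast)
  ultimately show ?thesis unfolding rc_mat_def using F(2-) by blast
qed

lemma fin_mat_mrestr:
  assumes "rc_mat L LF X" "finite F"
  shows "fin_mat L LF (mrestr X F)"
proof (rule fin_matI)
  have "{(x, y). mrestr X F x y \<noteq> 0} \<subseteq> Sigma F (\<lambda>x. {y. X x y \<noteq> 0})"
    by (auto simp: mrestr_def split: if_splits)
  moreover have "finite (Sigma F (\<lambda>x. {y. X x y \<noteq> 0}))"
    using assms by (intro finite_SigmaI) (auto simp: rc_mat_def)
  ultimately show "finite {(x, y). mrestr X F x y \<noteq> 0}" using finite_subset by blast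
qed (use assms in \<open>auto simp: mrestr_def rc_mat_def split: if_splits\<close>)

text \<open>Trades the input-dependent range of summation in \<open>opcomp\<close> for a fixed
  finite set, so that sums can be exchanged; finiteness of the row rules out the default value of an
  infinite sum.\<close>

lemma opcomp_eq_sum:
  assumes "finite {y. N x y \<noteq> 0}" "finite S" "\<And>y. N x y \<noteq> 0 \<Longrightarrow> M y z \<noteq> 0 \<Longrightarrow> y \<in> S"
  shows "opcomp M N x z = (\<Sum>y\<in>S. N x y * M y z)"
proof -
  let ?T = "{y. N x y \<noteq> 0}"
  have "(\<Sum>y\<in>?T. N x y * M y z) = (\<Sum>y\<in>?T \<inter> S. N x y * M y z)"
    using assms by (intro sum.mono_neutral_right) auto
  also have "\<dots> = (\<Sum>y\<in>S. N x y * M y z)"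
    using assms by (intro sum.mono_neutral_left) auto
  finally show ?thesis by (simp add: opcomp_def)
qed

lemma opcomp_nonzero:
  assumes "opcomp M N x z \<noteq> 0"
  shows "\<exists>y. N x y \<noteq> 0 \<and> M y z \<noteq> 0"
proof (rule ccontr)
  assume "\<not> ?thesis"
  then have "opcomp M N x z = 0" unfolding opcomp_def by (intro sum.neutral) auto
  then show False using assms by simp
qed

lemma rc_mat_opcomp:
  assumes M: "rc_mat L LF M" and N: "rc_mat L LF N"
  shows "rc_mat L LF (opcomp M N)"
  unfolding rc_mat_def
proof (intro conjI allI impI)
  fix x
  have "{z. opcomp M N x z \<noteq> 0} \<subseteq> (\<Union>y\<in>{y. N x y \<noteq> 0}. {z. M y z \<noteq> 0})"
    using opcomp_nonzero by blast
  moreover have "finite (\<Union>y\<in>{y. N x y \<noteq> 0}. {z. M y z \<noteq> 0})"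
    using M N unfolding rc_mat_def by blast
  ultimately show "finite {z. opcomp M N x z \<noteq> 0}" using finite_subset by blast
next
  fix z
  have "{x. opcomp M N x z \<noteq> 0} \<subseteq> (\<Union>y\<in>{y. M y z \<noteq> 0}. {x. N x y \<noteq> 0})"
    using opcomp_nonzero by blast
  moreover have "finite (\<Union>y\<in>{y. M y z \<noteq> 0}. {x. N x y \<noteq> 0})"
    using M N unfolding rc_mat_def by blast
  ultimately show "finite {x. opcomp M N x z \<noteq> 0}" using finite_subset by blast
next
  fix x z assume "opcomp M N x z \<noteq> 0"
  then obtain y where "N x y \<noteq> 0" "M y z \<noteq> 0" using opcomp_nonzero by blast
  then show "basis_ok L LF x" "basis_ok L LF z" using M N unfolding rc_mat_def by blast+
qed

lemma rc_mat_oplin: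
  assumes M: "rc_mat L LF M" and N: "rc_mat L LF N"
  shows "rc_mat L LF (oplin a M b N)"
  unfolding rc_mat_def
proof (intro conjI allI impI)
  fix x
  have "{z. oplin a M b N x z \<noteq> 0} \<subseteq> {z. M x z \<noteq> 0} \<union> {z. N x z \<noteq> 0}"
    by (auto simp: oplin_def)
  then show "finite {z. oplin a M b N x z \<noteq> 0}"
    using M N unfolding rc_mat_def by (meson finite_UnI finite_subset)
next
  fix z
  have "{x. oplin a M b N x z \<noteq> 0} \<subseteq> {x. M x z \<noteq> 0} \<union> {x. N x z \<noteq> 0}"
    by (auto simp: oplin_def)
  then show "finite {x. oplin a M b N x z \<noteq> 0}"
    using M N unfolding rc_mat_def by (meson finite_UnI finite_subset)
next
  fix x z assume "oplin a M b N x z \<noteq> 0"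
  then have "M x z \<noteq> 0 \<or> N x z \<noteq> 0" by (auto simp: oplin_def)
  then show "basis_ok L LF x" "basis_ok L LF z" using M N unfolding rc_mat_def by blast+
qed

lemma opcomm_eq_oplin: "opcomm M N = oplin 1 (opcomp M N) (-1) (opcomp N M)"
  by (simp add: opcomm_def oplin_def fun_eq_iff)

lemma rc_mat_opcomm: "rc_mat L LF M \<Longrightarrow> rc_mat L LF N \<Longrightarrow> rc_mat L LF (opcomm M N)"
  unfolding opcomm_eq_oplin by (intro rc_mat_oplin rc_mat_opcomp)

text \<open>If \<open>F\<close> supports \<open>A\<close>, the inputs of \<open>opcomp A X\<close>
  lie in the preimage of \<open>F\<close> under \<open>X\<close>, and the outputs of
  \<open>opcomp X A\<close> in its image; each of the two finiteness conditions in
  \<open>rc_mat\<close> serves one of them.\<close>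

lemma fin_mat_opcomp:
  assumes A: "fin_mat L LF A" and X: "rc_mat L LF X"
  shows "fin_mat L LF (opcomp A X)" "fin_mat L LF (opcomp X A)"
proof -
  obtain F where F: "finite F" "\<And>x y. A x y \<noteq> 0 \<Longrightarrow> x \<in> F" "\<And>x y. A x y \<noteq> 0 \<Longrightarrow> y \<in> F"
    using A by (metis fin_matE)
  have rc: "rc_mat L LF (opcomp A X)" "rc_mat L LF (opcomp X A)"
    using rc_mat_opcomp rc_mat_fin[OF A] X by blast+
  have "{(x, z). opcomp A X x z \<noteq> 0} \<subseteq> (\<Union>y\<in>F. {x. X x y \<noteq> 0}) \<times> F"
  proof (intro subrelI)
    fix x z assume "(x, z) \<in> {(x, z). opcomp A X x z \<noteq> 0}"
    then obtain y where "X x y \<noteq> 0" "A y z \<noteq> 0" using opcomp_nonzero[of A X x z] by blast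
    then show "(x, z) \<in> (\<Union>y\<in>F. {x. X x y \<noteq> 0}) \<times> F" using F by blast
  qed
  moreover have "finite ((\<Union>y\<in>F. {x. X x y \<noteq> 0}) \<times> F)"
    using F(1) X unfolding rc_mat_def by blast
  ultimately show "fin_mat L LF (opcomp A X)"
    using rc(1) finite_subset unfolding rc_mat_def by (intro fin_matI) blast+
  have "{(x, z). opcomp X A x z \<noteq> 0} \<subseteq> F \<times> (\<Union>y\<in>F. {z. X y z \<noteq> 0})"
  proof (intro subrelI)
    fix x z assume "(x, z) \<in> {(x, z). opcomp X A x z \<noteq> 0}"
    then obtain y where "A x y \<noteq> 0" "X y z \<noteq> 0" using opcomp_nonzero[of X A x z] by blast
    then show "(x, z) \<in> F \<times> (\<Union>y\<in>F. {z. X y z \<noteq> 0})" using F by blast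
  qed
  moreover have "finite (F \<times> (\<Union>y\<in>F. {z. X y z \<noteq> 0}))"
    using F(1) X unfolding rc_mat_def by blast
  ultimately show "fin_mat L LF (opcomp X A)"
    using rc(2) finite_subset unfolding rc_mat_def by (intro fin_matI) blast+
qed

lemma fin_mat_opcomm:
  assumes "fin_mat L LF A" "rc_mat L LF X"
  shows "fin_mat L LF (opcomm A X)"
  unfolding opcomm_eq_oplin using fin_mat_opcomp[OF assms] by (rule fin_mat_oplin)

text \<open>Both traces reduce to the same double sum over the finite support of \<open>A\<close>,
  so only one factor has to be finitary.\<close>

lemma mtrace_opcomm:
  assumes A: "fin_mat L LF A" and X: "rc_mat L LF X"
  shows "mtrace (opcomm A X) = 0"
proof -
  obtain F where F: "finite F" "\<And>x y. A x y \<noteq> 0 \<Longrightarrow> x \<in> F" "\<And>x y. A x y \<noteq> 0 \<Longrightarrow> y \<in> F"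
    using A by (metis fin_matE)
  have finA: "finite {y. A x y \<noteq> 0}" and finX: "finite {y. X x y \<noteq> 0}" for x
    using rc_mat_fin[OF A] X unfolding rc_mat_def by blast+
  have 1: "opcomp A X x z = (\<Sum>y\<in>F. X x y * A y z)" "opcomp X A x z = (\<Sum>y\<in>F. A x y * X y z)" for x z
    by (rule opcomp_eq_sum; use F finA finX in blast)+
  have "mtrace (opcomp A X) = (\<Sum>x\<in>F. opcomp A X x x)" "mtrace (opcomp X A) = (\<Sum>x\<in>F. opcomp X A x x)"
    by (rule mtrace_eq_sum; use F opcomp_nonzero in blast)+
  then have "mtrace (opcomp A X) = (\<Sum>x\<in>F. \<Sum>y\<in>F. X x y * A y x)"
    and "mtrace (opcomp X A) = (\<Sum>x\<in>F. \<Sum>y\<in>F. A x y * X y x)" by (simp_all add: 1)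
  moreover have "(\<Sum>x\<in>F. \<Sum>y\<in>F. X x y * A y x) = (\<Sum>x\<in>F. \<Sum>y\<in>F. A x y * X y x)"
    by (subst sum.swap) (simp add: mult.commute)
  ultimately show ?thesis
    unfolding opcomm_eq_oplin mtrace_oplin[OF fin_mat_opcomp[OF A X]] by simp
qed

lemma opcomp_unit_unit: "opcomp (unit_mat y z) (unit_mat x w) = (if w = y then unit_mat x z else (\<lambda>_ _. 0))"
proof -
  have fin: "finite {b. unit_mat x w a b \<noteq> 0}" for a
    by (rule finite_subset[of _ "{w}"]) (auto simp: unit_mat_def)
  have "opcomp (unit_mat y z) (unit_mat x w) a b = (\<Sum>d\<in>{w}. unit_mat x w a d * unit_mat y z d b)" for a b
    using fin by (intro opcomp_eq_sum) (auto simp: unit_mat_def split: if_splits)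
  then show ?thesis by (auto simp: fun_eq_iff unit_mat_def)
qed

text \<open>On inputs from \<open>F\<close> the inner factor of a product lands in
  \<open>F'\<close>, so cutting the outer factor to inputs in \<open>F'\<close> is invisible;
  cutting the inner one is invisible since \<open>F\<close> lies in \<open>F'\<close>. Brackets of
  infinite matrices are thereby computed with truncations.\<close>

lemma opcomm_mrestr:
  assumes "F \<subseteq> F'" "\<And>x y. x \<in> F \<Longrightarrow> X x y \<noteq> 0 \<or> Y x y \<noteq> 0 \<Longrightarrow> y \<in> F'"
  shows "mrestr (opcomm (mrestr X F') (mrestr Y F')) F = mrestr (opcomm X Y) F"
    and "mrestr (opcomm (mrestr X F') Y) F = mrestr (opcomm X Y) F"
proof -
  have 1: "opcomp (mrestr M F') N x z = opcomp M N x z"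
    if "\<And>y. N x y \<noteq> 0 \<Longrightarrow> y \<in> F'" for M N x z
    unfolding opcomp_def using that by (intro sum.cong) (auto simp: mrestr_def)
  have 2: "opcomp M (mrestr N F') x z = opcomp M N x z" if "x \<in> F'" for M N x z
    unfolding opcomp_def using that by (intro sum.cong) (auto simp: mrestr_def)
  have 3: "y \<in> F'" if "x \<in> F" "mrestr X F' x y \<noteq> 0 \<or> mrestr Y F' x y \<noteq> 0" for x y
    using that assms(2)[of x y] by (auto simp: mrestr_def split: if_splits)
  have "opcomp (mrestr X F') (mrestr Y F') x z = opcomp X Y x z"
    "opcomp (mrestr Y F') (mrestr X F') x z = opcomp Y X x z"
    "opcomp (mrestr X F') Y x z = opcomp X Y x z"
    "opcomp Y (mrestr X F') x z = opcomp Y X x z" if "x \<in> F" for x z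
  proof -
    have x: "x \<in> F'" using that assms(1) by blast
    show "opcomp (mrestr X F') (mrestr Y F') x z = opcomp X Y x z"
      using 1[of "mrestr Y F'" x X z] 2[OF x, of X Y z] 3[OF that] by simp
    show "opcomp (mrestr Y F') (mrestr X F') x z = opcomp Y X x z"
      using 1[of "mrestr X F'" x Y z] 2[OF x, of Y X z] 3[OF that] by simp
    show "opcomp (mrestr X F') Y x z = opcomp X Y x z"
      using 1[of Y x X z] assms(2)[OF that] by simp
    show "opcomp Y (mrestr X F') x z = opcomp Y X x z" by (rule 2[OF x])
  qed
  then show "mrestr (opcomm (mrestr X F') (mrestr Y F')) F = mrestr (opcomm X Y) F"
    and "mrestr (opcomm (mrestr X F') Y) F = mrestr (opcomm X Y) F"
    by (simp_all add: mrestr_def[of _ F] opcomm_def fun_eq_iff)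
qed

text \<open>Whether \<open>A\<close> acts before or after \<open>X\<close>, an input from
  \<open>F\<close> meets \<open>A\<close> inside \<open>F'\<close>, where \<open>A\<close>
  vanishes.\<close>

lemma opcomm_vanish:
  assumes "F \<subseteq> F'" "\<And>x y. x \<in> F \<Longrightarrow> X x y \<noteq> 0 \<Longrightarrow> y \<in> F'" "\<And>x y. x \<in> F' \<Longrightarrow> A x y = 0" "x \<in> F"
  shows "opcomm A X x y = 0"
proof -
  have "opcomp A X x y = 0" using opcomp_nonzero[of A X x y] assms by blast
  moreover have "opcomp X A x y = 0" using opcomp_nonzero[of X A x y] assms by blast
  ultimately show ?thesis by (simp add: opcomm_def)
qed

lemma mrestr_oplin: "mrestr (oplin a X b Y) F = oplin a (mrestr X F) b (mrestr Y F)"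
  by (auto simp: mrestr_def oplin_def fun_eq_iff)

lemma fin_mat_mrestr_fin:
  assumes "fin_mat L LF A"
  shows "fin_mat L LF (mrestr A F)"
proof -
  obtain S where "finite S" "\<forall>x\<in>S. basis_ok L LF x" "\<forall>x y. A x y \<noteq> 0 \<longrightarrow> x \<in> S \<and> y \<in> S"
    using assms unfolding fin_mat_def by blast
  moreover from this have "\<forall>x y. mrestr A F x y \<noteq> 0 \<longrightarrow> x \<in> S \<and> y \<in> S"
    unfolding mrestr_def by metis
  ultimately show ?thesis unfolding fin_mat_def by blast
qed

lemma mrestr_mrestr: "mrestr (mrestr X F) F' = mrestr X (F \<inter> F')"
  by (intro ext) (simp add: mrestr_def)

lemma madj_oplin: "madj (oplin a A b B) = oplin (cnj a) (madj A) (cnj b) (madj B)"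
  by (simp add: madj_def oplin_def)

lemma madj_unit: "madj (unit_mat x y) = unit_mat y x"
  by (intro ext) (simp add: madj_def unit_mat_def)

section \<open>Linear spans of operators\<close>

lemma opspan_base: "g \<in> S \<Longrightarrow> g \<in> opspan S"
  unfolding opspan_def by (rule CollectI, rule exI[of _ "{g}"], rule exI[of _ "\<lambda>_. 1"]) auto

lemma opspan_zero: "(\<lambda>x y. 0) \<in> opspan S"
  unfolding opspan_def by (rule CollectI, rule exI[of _ "{}"]) auto

lemma opspan_oplin:
  assumes "X \<in> opspan S" "Y \<in> opspan S"
  shows "oplin a X b Y \<in> opspan S"
proof -
  obtain T c where T: "finite T" "T \<subseteq> S" "X = (\<lambda>x y. \<Sum>g\<in>T. c g * g x y)"
    using assms(1) unfolding opspan_def by blast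
  obtain U d where U: "finite U" "U \<subseteq> S" "Y = (\<lambda>x y. \<Sum>g\<in>U. d g * g x y)"
    using assms(2) unfolding opspan_def by blast
  let ?e = "\<lambda>g. a * (if g \<in> T then c g else 0) + b * (if g \<in> U then d g else 0)"
  have X: "X x y = (\<Sum>g\<in>T \<union> U. (if g \<in> T then c g else 0) * g x y)" for x y
    unfolding T(3) using T U by (intro sum.mono_neutral_cong_left) auto
  have Y: "Y x y = (\<Sum>g\<in>T \<union> U. (if g \<in> U then d g else 0) * g x y)" for x y
    unfolding U(3) using T U by (intro sum.mono_neutral_cong_left) auto
  have "oplin a X b Y = (\<lambda>x y. \<Sum>g\<in>T \<union> U. ?e g * g x y)"
    unfolding oplin_def X Y by (simp add: sum_distrib_left sum.distrib[symmetric] algebra_simps)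
  then show ?thesis unfolding opspan_def using T(1,2) U(1,2)
    by (intro CollectI exI[of _ "T \<union> U"] exI[of _ ?e]) auto
qed

lemma opspan_induct [consumes 1, case_names zero base oplin]:
  assumes "X \<in> opspan S"
    and zero: "P (\<lambda>x y. 0)" and base: "\<And>g. g \<in> S \<Longrightarrow> P g"
    and lin: "\<And>a b X Y. X \<in> opspan S \<Longrightarrow> Y \<in> opspan S \<Longrightarrow> P X \<Longrightarrow> P Y \<Longrightarrow> P (oplin a X b Y)"
  shows "P X"
proof -
  obtain T c where T: "finite T" "T \<subseteq> S" "X = (\<lambda>x y. \<Sum>g\<in>T. c g * g x y)"
    using assms(1) unfolding opspan_def by blast
  have "(\<lambda>x y. \<Sum>g\<in>T. c g * g x y) \<in> opspan S \<and> P (\<lambda>x y. \<Sum>g\<in>T. c g * g x y)"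
    using T(1,2)
  proof (induction T rule: finite_induct)
    case empty
    then show ?case using zero opspan_zero by simp
  next
    case (insert g T)
    let ?B = "\<lambda>x y. \<Sum>g\<in>T. c g * g x y"
    have eq: "(\<lambda>x y. \<Sum>g\<in>insert g T. c g * g x y) = oplin (c g) g 1 ?B"
      using insert by (simp add: oplin_def)
    have g: "g \<in> S" and B: "?B \<in> opspan S" "P ?B" using insert by auto
    show ?case unfolding eq using lin[OF opspan_base[OF g] B(1) base[OF g] B(2)] opspan_oplin[OF opspan_base[OF g] B(1)] by blast
  qed
  then show ?thesis using T(3) by simp
qed

lemma opspan_mono:
  assumes "X \<in> opspan S" "S \<subseteq> T"
  shows "X \<in> opspan T"
  using assms(1)
proof (induction rule: opspan_induct)
  case zero show ?case by (rule opspan_zero)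
next
  case (base g) then show ?case using assms(2) opspan_base by blast
next
  case (oplin a b X Y) then show ?case by (simp add: opspan_oplin)
qed

lemma Ghat_gen: "valid_gen L LF g \<Longrightarrow> opm_of L LF g \<in> Ghat L LF"
  unfolding Ghat_def by (rule opspan_base) auto

lemma unit_mat_Ghat: "basis_ok L LF x \<Longrightarrow> basis_ok L LF y \<Longrightarrow> unit_mat x y \<in> Ghat L LF"
  using Ghat_gen[OF valid_unit_gen] opm_of_unit_gen by metis

lemma fin_mat_Ghat: "fin_mat L LF A \<Longrightarrow> A \<in> Ghat L LF"
  by (induction rule: fin_mat_induct)
    (auto simp: unit_mat_Ghat, auto simp: Ghat_def opspan_zero opspan_oplin)

lemma Gminus_Ghat: "X \<in> Gminus L LF \<Longrightarrow> X \<in> Ghat L LF"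
  unfolding Gminus_def Ghat_def by (erule opspan_mono) auto

lemma G00_Ghat: "X \<in> G00 L LF \<Longrightarrow> X \<in> Ghat L LF"
  unfolding G00_def Ghat_def by (erule opspan_mono) auto

subsection \<open>The generators as matrices\<close>

text \<open>The word followed by the two end labels, as in the ordering of first-kind operators:
  such an operator belongs to the lowering part exactly when its source has the larger key.\<close>

fun key :: "tbasis \<Rightarrow> nat list" where
  "key (a, K, b) = K @ [a, b]"

lemma seq_gt_Cons:
  assumes "length a = length b"
  shows "seq_gt (u # a) (v # b) \<longleftrightarrow> u > v \<or> (u = v \<and> seq_gt a b)"
proof -
  have "seq_gt (u # a) (v # b) \<longleftrightarrow> (\<exists>r<Suc (length a). take r (u # a) = take r (v # b) \<and> (u # a) ! r > (v # b) ! r)"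
    using assms by (simp add: seq_gt_def)
  also have "\<dots> \<longleftrightarrow> u > v \<or> (\<exists>r<length a. u = v \<and> take r a = take r b \<and> a ! r > b ! r)"
    by (subst Ex_less_Suc2) auto
  also have "\<dots> \<longleftrightarrow> u > v \<or> (u = v \<and> seq_gt a b)"
    using assms by (auto simp: seq_gt_def)
  finally show ?thesis .
qed

lemma seq_gt_append:
  assumes "length J = length I" "length s = length t"
  shows "seq_gt (J @ s) (I @ t) \<longleftrightarrow> seq_gt J I \<or> (J = I \<and> seq_gt s t)"
  using assms
proof (induction J I rule: list_induct2)
  case Nil
  then show ?case by (simp add: seq_gt_def)
next
  case (Cons x xs y ys)
  then show ?case by (auto simp: seq_gt_Cons)
qed

lemma seq_gt_total: "seq_gt a b \<or> a = b \<or> seq_gt b a"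
proof (cases "length a = length b")
  case True
  then show ?thesis
    by (induction a b rule: list_induct2) (auto simp: seq_gt_Cons)
next
  case False
  then show ?thesis by (auto simp: seq_gt_def)
qed

lemma key_inj: "key x = key y \<Longrightarrow> x = y"
  by (cases x; cases y) auto

lemma sum_indicator_card: "finite A \<Longrightarrow> (\<Sum>n\<in>A. if P n then 1 else (0::complex)) = of_nat (card {n \<in> A. P n})"
  by (simp add: sum.inter_filter[symmetric])

text \<open>Counting the common remainders \<open>Q\<close> instead of cut positions makes the entry
  symmetric under exchanging source with target and \<open>J\<close> with \<open>I\<close>;
  transposition by \<open>omega_gen\<close> is read off from this form.\<close>

lemma opm_of_Gl:
  "opm_of L LF (Gl l1 l2 I J) (a, K, b) (a', K', b') =
     (if basis_ok L LF (a, K, b) \<and> a = l2 \<and> a' = l1 \<and> b' = b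
      then of_nat (card {Q. K = J @ Q \<and> K' = I @ Q}) else 0)"
proof -
  have "card {n \<in> {0..length K}. take n K = J \<and> K' = I @ drop n K} = card {Q. K = J @ Q \<and> K' = I @ Q}"
    by (rule bij_betw_same_card[of "\<lambda>n. drop n K"], rule bij_betw_byWitness[where f' = "\<lambda>Q. length K - length Q"])
       auto
  then show ?thesis by (auto simp: sum_indicator_card)
qed

lemma opm_of_Gr:
  "opm_of L LF (Gr I J l1 l2) (a, K, b) (a', K', b') =
     (if basis_ok L LF (a, K, b) \<and> b = l2 \<and> b' = l1 \<and> a' = a
      then of_nat (card {P. K = P @ J \<and> K' = P @ I}) else 0)"
proof -
  have "card {n \<in> {0..length K}. drop n K = J \<and> K' = take n K @ I} = card {P. K = P @ J \<and> K' = P @ I}"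
    by (rule bij_betw_same_card[of "\<lambda>n. take n K"], rule bij_betw_byWitness[where f' = length])
       auto
  then show ?thesis by (auto simp: sum_indicator_card)
qed

lemma opm_of_Gs:
  "opm_of L LF (Gs I J) (a, K, b) (a', K', b') =
     (if basis_ok L LF (a, K, b) \<and> a' = a \<and> b' = b
      then of_nat (card {(P, Q). K = P @ J @ Q \<and> K' = P @ I @ Q}) else 0)"
proof -
  let ?A = "{(i, j). i \<le> j \<and> j \<le> length K}"
  have fin: "finite ?A" by (rule finite_subset[of _ "{..length K} \<times> {..length K}"]) auto
  have split: "take i K @ take (j - i) (drop i K) @ drop j K = K" if "i \<le> j" "j \<le> length K" for i j
    using that by (metis append_take_drop_id le_add_diff_inverse2 drop_drop)
  have "bij_betw (\<lambda>(i, j). (take i K, drop j K))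
      {p \<in> ?A. case p of (i, j) \<Rightarrow> take (j - i) (drop i K) = J \<and> K' = take i K @ I @ drop j K}
      {(P, Q). K = P @ J @ Q \<and> K' = P @ I @ Q}"
    by (rule bij_betw_byWitness[where f' = "\<lambda>(P, Q). (length P, length K - length Q)"])
       (auto simp: split)
  from bij_betw_same_card[OF this]
  have "card {p \<in> ?A. case p of (i, j) \<Rightarrow> take (j - i) (drop i K) = J \<and> K' = take i K @ I @ drop j K} =
    card {(P, Q). K = P @ J @ Q \<and> K' = P @ I @ Q}" .
  moreover have "(\<Sum>(i, j)\<in>?A. if take (j - i) (drop i K) = J \<and> (a', K', b') = (a, take i K @ I @ drop j K, b) then 1 else 0)
     = (\<Sum>p\<in>?A. if case p of (i, j) \<Rightarrow> take (j - i) (drop i K) = J \<and> (a', K', b') = (a, take i K @ I @ drop j K, b) then 1 else (0::complex))"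
    by (rule sum.cong) (simp_all add: case_prod_beta)
  ultimately show ?thesis
    by (auto simp: sum_indicator_card[OF fin])
qed

declare opm_of.simps [simp del]

lemma opm_of_Gf:
  "opm_of L LF (Gf l1 l2 I J l3 l4) (a, K, b) (a', K', b') =
     (if basis_ok L LF (a, K, b) \<and> a = l2 \<and> K = J \<and> b = l4 \<and> a' = l1 \<and> K' = I \<and> b' = l3 then 1 else 0)"
  by (simp add: opm_of.simps)

lemma valid_seq_append [simp]: "valid_seq L (I @ J) \<longleftrightarrow> valid_seq L I \<and> valid_seq L J"
  by (auto simp: valid_seq_def)

lemma opm_of_Gf_nonzeroD:
  assumes "opm_of L LF (Gf l1 l2 I J l3 l4) x y \<noteq> 0"
  shows "x = (l2, J, l4) \<and> y = (l1, I, l3) \<and> basis_ok L LF x"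
  using assms by (cases x; cases y) (auto simp: opm_of_Gf split: if_splits)

lemma opm_of_Gl_nonzeroD:
  assumes "opm_of L LF (Gl l1 l2 I J) x y \<noteq> 0"
  shows "\<exists>Q b. x = (l2, J @ Q, b) \<and> y = (l1, I @ Q, b) \<and> basis_ok L LF x"
  using assms by (cases x; cases y) (auto simp: opm_of_Gl card_gt_0_iff split: if_splits)

lemma opm_of_Gr_nonzeroD:
  assumes "opm_of L LF (Gr I J l1 l2) x y \<noteq> 0"
  shows "\<exists>P a. x = (a, P @ J, l2) \<and> y = (a, P @ I, l1) \<and> basis_ok L LF x"
  using assms by (cases x; cases y) (auto simp: opm_of_Gr card_gt_0_iff split: if_splits)

lemma opm_of_Gs_nonzeroD:
  assumes "opm_of L LF (Gs I J) x y \<noteq> 0"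
  shows "\<exists>P Q a b. x = (a, P @ J @ Q, b) \<and> y = (a, P @ I @ Q, b) \<and> basis_ok L LF x"
  using assms by (cases x; cases y) (auto simp: opm_of_Gs card_gt_0_iff split: if_splits)

lemmas opm_of_nonzeroD = opm_of_Gf_nonzeroD opm_of_Gl_nonzeroD opm_of_Gr_nonzeroD opm_of_Gs_nonzeroD

lemma opm_of_ok:
  assumes "valid_gen L LF g" "opm_of L LF g x y \<noteq> 0"
  shows "basis_ok L LF x \<and> basis_ok L LF y"
  using assms by (cases g) (auto dest!: opm_of_nonzeroD simp: basis_ok_def)

text \<open>The factorisation counts are symmetric, but \<open>opm_of\<close> tests admissibility on
  the input only. Validity of the generator transfers it to the output, which settles the case of an
  inadmissible basis vector.\<close>

lemma opm_of_omega:
  assumes "valid_gen L LF g"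
  shows "opm_of L LF (omega_gen g) x y = opm_of L LF g y x"
proof -
  have valid': "valid_gen L LF (omega_gen g)" using assms by (cases g) auto
  obtain a K b a' K' b' where xy: "x = (a, K, b)" "y = (a', K', b')" by (cases x; cases y)
  show ?thesis
  proof (cases "basis_ok L LF x \<and> basis_ok L LF y")
    case True
    have eqs: "{Q. K = I @ Q \<and> K' = J @ Q} = {Q. K' = J @ Q \<and> K = I @ Q}"
      "{P. K = P @ I \<and> K' = P @ J} = {P. K' = P @ J \<and> K = P @ I}"
      "{(P, Q). K = P @ I @ Q \<and> K' = P @ J @ Q} = {(P, Q). K' = P @ J @ Q \<and> K = P @ I @ Q}" for I J
      by auto
    show ?thesis using True unfolding xy
      by (cases g) (auto simp: opm_of_Gf opm_of_Gl opm_of_Gr opm_of_Gs eqs)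
  next
    case False
    then have "opm_of L LF (omega_gen g) x y = 0" "opm_of L LF g y x = 0"
      using opm_of_ok assms valid' by blast+
    then show ?thesis by simp
  qed
qed

lemma finite_opm_of_row:
  "finite {y. opm_of L LF g x y \<noteq> 0}"
proof (cases g)
  case (Gf l1 l2 I J l3 l4)
  have "{y. opm_of L LF g x y \<noteq> 0} \<subseteq> {(l1, I, l3)}"
    unfolding Gf using opm_of_Gf_nonzeroD by blast
  then show ?thesis using finite_subset by blast
next
  case (Gl l1 l2 I J)
  have "{y. opm_of L LF g x y \<noteq> 0} \<subseteq> {(l1, I @ drop (length J) (fst (snd x)), snd (snd x))}"
    unfolding Gl by (auto dest!: opm_of_Gl_nonzeroD)
  then show ?thesis using finite_subset by blast
next
  case (Gr I J l1 l2)
  have "{y. opm_of L LF g x y \<noteq> 0} \<subseteq> {(fst x, take (length (fst (snd x)) - length J) (fst (snd x)) @ I, l1)}"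
    unfolding Gr by (auto dest!: opm_of_Gr_nonzeroD)
  then show ?thesis using finite_subset by blast
next
  case (Gs I J)
  obtain a K b where x: "x = (a, K, b)" by (cases x)
  have "{y. opm_of L LF g x y \<noteq> 0} \<subseteq> (\<lambda>(i, j). (a, take i K @ I @ drop j K, b)) ` ({..length K} \<times> {..length K})"
  proof
    fix y assume "y \<in> {y. opm_of L LF g x y \<noteq> 0}"
    then obtain P Q where "K = P @ J @ Q" "y = (a, P @ I @ Q, b)"
      unfolding Gs x by (auto dest!: opm_of_Gs_nonzeroD)
    then have "y = (\<lambda>(i, j). (a, take i K @ I @ drop j K, b)) (length P, length P + length J)"
      "(length P, length P + length J) \<in> {..length K} \<times> {..length K}" by auto
    then show "y \<in> (\<lambda>(i, j). (a, take i K @ I @ drop j K, b)) ` ({..length K} \<times> {..length K})" by blast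
  qed
  then show ?thesis by (rule finite_subset) auto
qed

text \<open>Finitely many inputs per output is the row statement for the transposed generator
  \<open>omega_gen g\<close>.\<close>

lemma rc_mat_opm_of:
  assumes "valid_gen L LF g"
  shows "rc_mat L LF (opm_of L LF g)"
  unfolding rc_mat_def
  using finite_opm_of_row opm_of_ok[OF assms]
    finite_opm_of_row[of L LF "omega_gen g", unfolded opm_of_omega[OF assms]] by blast

lemma rc_mat_Ghat: "X \<in> Ghat L LF \<Longrightarrow> rc_mat L LF X"
  unfolding Ghat_def
proof (induction rule: opspan_induct)
  case zero show ?case by (rule rc_mat_fin[OF fin_mat_zero])
next
  case (base g) then show ?case using rc_mat_opm_of by blast
next
  case (oplin a b X Y) then show ?case by (simp add: rc_mat_oplin)
qed

text \<open>The \<open>l\<close>, \<open>r\<close> and \<open>sigma\<close> operators replace a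
  piece of a longer word. Padding by a common prefix and suffix preserves the comparison of the
  pieces, and when the pieces agree the end labels decide.\<close>

lemma opm_of_neg_lowers:
  assumes "neg_gen g" "opm_of L LF g x y \<noteq> 0"
  shows "seq_gt (key x) (key y)"
proof -
  have len: "seq_gt s t" if "length t < length s" for s t using that by (simp add: seq_gt_def)
  have irr: "\<not> seq_gt s s" for s by (auto simp: seq_gt_def)
  show ?thesis
  proof (cases g)
    case (Gf l1 l2 I J l3 l4)
    then show ?thesis using assms len by (auto dest!: opm_of_Gf_nonzeroD)
  next
    case (Gl l1 l2 I J)
    then show ?thesis using assms len by (auto dest!: opm_of_Gl_nonzeroD simp: seq_gt_append seq_gt_Cons irr)
  next
    case (Gr I J l1 l2)
    then show ?thesis using assms len by (auto dest!: opm_of_Gr_nonzeroD simp: seq_gt_append seq_gt_Cons irr)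
  next
    case (Gs I J)
    then show ?thesis using assms len by (auto dest!: opm_of_Gs_nonzeroD simp: seq_gt_append seq_gt_Cons irr)
  qed
qed

lemma Gminus_lowers: "X \<in> Gminus L LF \<Longrightarrow> X x y \<noteq> 0 \<Longrightarrow> seq_gt (key x) (key y)"
  unfolding Gminus_def
proof (induction rule: opspan_induct)
  case (base g) then show ?case using opm_of_neg_lowers by blast
next
  case (oplin a b X Y)
  then have "X x y \<noteq> 0 \<or> Y x y \<noteq> 0" by (auto simp: oplin_def)
  then show ?case using oplin by blast
qed simp

lemma opm_of_diag_diagonal: "diag_gen g \<Longrightarrow> opm_of L LF g x y \<noteq> 0 \<Longrightarrow> x = y"
  by (cases g) (auto dest!: opm_of_nonzeroD)

lemma G00_diagonal: "X \<in> G00 L LF \<Longrightarrow> X x y \<noteq> 0 \<Longrightarrow> x = y"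
  unfolding G00_def
proof (induction rule: opspan_induct)
  case (base g) then show ?case using opm_of_diag_diagonal by blast
next
  case (oplin a b X Y)
  then have "X x y \<noteq> 0 \<or> Y x y \<noteq> 0" by (auto simp: oplin_def)
  then show ?case using oplin by blast
qed simp

lemma opm_of_real: "opm_of L LF g x y \<in> \<real>"
  by (cases g; cases x; cases y) (auto simp: opm_of_Gf opm_of_Gl opm_of_Gr opm_of_Gs)

lemma unit_mat_Gminus:
  assumes "basis_ok L LF x" "basis_ok L LF y" "seq_gt (key x) (key y)"
  shows "unit_mat x y \<in> Gminus L LF"
proof -
  have "neg_gen (unit_gen x y)" using assms(3) by (cases x; cases y) (auto simp: seq_gt_def)
  then show ?thesis unfolding Gminus_def
    using valid_unit_gen[OF assms(1,2)] opm_of_unit_gen[OF assms(1), of y] by (metis (mono_tags, lifting) image_eqI mem_Collect_eq opspan_base)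
qed

lemma unit_mat_G00:
  assumes "basis_ok L LF x"
  shows "unit_mat x x \<in> G00 L LF"
proof -
  have "diag_gen (unit_gen x x)" by (cases x) auto
  then show ?thesis unfolding G00_def
    using valid_unit_gen[OF assms assms] opm_of_unit_gen[OF assms, of x] by (metis (mono_tags, lifting) image_eqI mem_Collect_eq opspan_base)
qed

lemma fin_mat_gl_inf: "A \<in> gl_inf L LF \<Longrightarrow> fin_mat L LF A"
  unfolding gl_inf_def
proof (induction rule: opspan_induct)
  case zero show ?case by (rule fin_mat_zero)
next
  case (base X)
  then obtain g where g: "X = opm_of L LF g" "valid_gen L LF g" "is_first_kind g" by blast
  then obtain x y where xy: "g = unit_gen x y" "basis_ok L LF x" "basis_ok L LF y"
  proof (cases g)
    case (Gf l1 l2 I J l3 l4)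
    then have "g = unit_gen (l2, J, l4) (l1, I, l3)" by simp
    then show ?thesis using that g Gf by (auto simp: basis_ok_def)
  qed (use g in auto)
  then show ?case using g opm_of_unit_gen fin_mat_unit by metis
next
  case (oplin a b X Y) then show ?case by (simp add: fin_mat_oplin)
qed

lemma sl_inf_traceless: "X \<in> sl_inf L LF \<Longrightarrow> fin_mat L LF X \<and> mtrace X = 0"
  unfolding sl_inf_def
proof (induction rule: opspan_induct)
  case zero show ?case by (simp add: fin_mat_zero mtrace_def)
next
  case (base X)
  then show ?case using fin_mat_opcomm mtrace_opcomm fin_mat_gl_inf rc_mat_fin by blast
next
  case (oplin a b X Y) then show ?case using mtrace_oplin[of L LF X Y a b] by (simp add: fin_mat_oplin)
qed

lemma finite_basis_length_le: "finite {x. basis_ok L LF x \<and> length (fst (snd x)) \<le> n}"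
proof -
  have "{x. basis_ok L LF x \<and> length (fst (snd x)) \<le> n} \<subseteq>
     {1..LF} \<times> {K. set K \<subseteq> {1..L} \<and> length K \<le> n} \<times> {1..LF}"
    by (auto simp: basis_ok_def valid_lam_def valid_seq_def)
  then show ?thesis
    by (rule finite_subset) (auto intro!: finite_cartesian_product finite_lists_length_le)
qed

subsection \<open>Unitarity constrains the lowest weight\<close>

text \<open>The normalisation \<open>form v v = 1\<close> lets the form factorise later without
  correction factors.\<close>

locale unitary_lw_rep = vector_space scale
  for scale :: "complex \<Rightarrow> 'v::ab_group_add \<Rightarrow> 'v" +
  fixes L LF :: nat
    and rho :: "opm \<Rightarrow> 'v \<Rightarrow> 'v"
    and form :: "'v \<Rightarrow> 'v \<Rightarrow> complex"
    and h :: "opm \<Rightarrow> complex"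
    and v :: 'v
  assumes L_pos: "L > 0" and LF_pos: "LF > 0"
    and rep: "is_rep L LF scale rho UNIV"
    and form_lin: "form (scale a u + scale b u') w = a * form u w + b * form u' w"
    and form_herm: "form w u = cnj (form u w)"
    and form_pos: "u \<noteq> 0 \<Longrightarrow> Re (form u u) > 0"
    and form_omega: "valid_gen L LF g \<Longrightarrow>
      form (rho (opm_of L LF g) u) w = form u (rho (opm_of L LF (omega_gen g)) w)"
    and lw: "lowest_weight_rep L LF scale rho UNIV h v"
    and norm_v: "form v v = 1"
begin

abbreviation ok :: "tbasis \<Rightarrow> bool" where "ok \<equiv> basis_ok L LF"
abbreviation fin :: "opm \<Rightarrow> bool" where "fin \<equiv> fin_mat L LF"
abbreviation rc :: "opm \<Rightarrow> bool" where "rc \<equiv> rc_mat L LF"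
abbreviation G :: "opm set" where "G \<equiv> Ghat L LF"

lemma form_add_left: "form (u + u') w = form u w + form u' w"
  using form_lin[of 1 u 1 u' w] by simp

lemma form_scale_left: "form (scale a u) w = a * form u w"
  using form_lin[of a u 0 u w] by simp

lemma form_add_right: "form w (u + u') = form w u + form w u'"
  unfolding form_herm[of w] by (simp add: form_add_left)

lemma form_scale_right: "form w (scale a u) = cnj a * form w u"
  unfolding form_herm[of w] by (simp add: form_scale_left)

lemma form_zero_left [simp]: "form 0 w = 0"
  using form_scale_left[of 0 0 w] by simp

lemma form_zero_right [simp]: "form w 0 = 0"
  using form_scale_right[of w 0 0] by simp

lemma form_diff_left: "form (u - u') w = form u w - form u' w"
  using form_add_left[of "u - u'" u' w] by simp

lemma form_diff_right: "form w (u - u') = form w u - form w u'"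
  using form_add_right[of w "u - u'" u'] by simp

lemma form_sum_left: "form (\<Sum>i\<in>S. f i) w = (\<Sum>i\<in>S. form (f i) w)"
  by (induction S rule: infinite_finite_induct) (simp_all add: form_add_left)

lemma form_self_zero: "form u u = 0 \<Longrightarrow> u = 0"
  using form_pos[of u] by (cases "u = 0") auto

lemma form_self_nonneg: "Re (form u u) \<ge> 0"
  using form_pos[of u] by (cases "u = 0") auto

lemma v_nonzero: "v \<noteq> 0"
  using norm_v by auto

lemma rho_lin: "X \<in> G \<Longrightarrow> rho X (scale a u + scale b u') = scale a (rho X u) + scale b (rho X u')"
  using rep unfolding is_rep_def by blast

lemma rho_add: "X \<in> G \<Longrightarrow> rho X (u + u') = rho X u + rho X u'"
  using rho_lin[of X 1 u 1 u'] by simp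

lemma rho_scale: "X \<in> G \<Longrightarrow> rho X (scale a u) = scale a (rho X u)"
  using rho_lin[of X a u 0 u] by simp

lemma rho_zero: "X \<in> G \<Longrightarrow> rho X 0 = 0"
  using rho_scale[of X 0 0] by simp

lemma rho_diff: "X \<in> G \<Longrightarrow> rho X (u - u') = rho X u - rho X u'"
  using rho_add[of X "u - u'" u'] by simp

lemma rho_oplin: "X \<in> G \<Longrightarrow> Y \<in> G \<Longrightarrow> rho (oplin a X b Y) u = scale a (rho X u) + scale b (rho Y u)"
  using rep unfolding is_rep_def by blast

lemma rho_opcomm: "X \<in> G \<Longrightarrow> Y \<in> G \<Longrightarrow> rho (opcomm X Y) u = rho X (rho Y u) - rho Y (rho X u)"
  using rep unfolding is_rep_def by blast

lemma rho_zero_mat: "rho (\<lambda>x y. 0) u = 0"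
  using rho_oplin[of "\<lambda>x y. 0" "\<lambda>x y. 0" 0 0 u] fin_mat_Ghat[OF fin_mat_zero, of L LF]
  by (simp add: oplin_def)

lemma rho_unit_adj:
  assumes "ok x" "ok y"
  shows "form (rho (unit_mat x y) u) w = form u (rho (unit_mat y x) w)"
  using form_omega[OF valid_unit_gen[OF assms]] assms by (simp add: opm_of_unit_gen omega_unit_gen)

definition wt :: "tbasis \<Rightarrow> complex" where
  "wt x = h (unit_mat x x)"

lemma lw_Gminus: "X \<in> Gminus L LF \<Longrightarrow> rho X v = 0"
  and lw_G00: "H \<in> G00 L LF \<Longrightarrow> rho H v = scale (h H) v"
  and lw_functional: "lowest_weight_functional L LF h"
  and lw_generates: "\<And>U. v \<in> U \<Longrightarrow> invariant_subspace L LF scale rho U \<Longrightarrow> U = UNIV"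
  using lw by (simp_all add: lowest_weight_rep_def)

lemma wt_real: "ok x \<Longrightarrow> wt x \<in> \<real>"
proof -
  assume x: "ok x"
  have "diag_gen (unit_gen x x)" by (cases x) auto
  then have "h (opm_of L LF (unit_gen x x)) \<in> \<real>"
    using lw_functional valid_unit_gen[OF x x] by (simp add: lowest_weight_functional_def)
  then show ?thesis by (simp add: wt_def opm_of_unit_gen[OF x])
qed

lemma lower_v: "ok x \<Longrightarrow> ok y \<Longrightarrow> seq_gt (key x) (key y) \<Longrightarrow> rho (unit_mat x y) v = 0"
  by (rule lw_Gminus[OF unit_mat_Gminus])

lemma diag_v: "ok x \<Longrightarrow> rho (unit_mat x x) v = scale (wt x) v"
  unfolding wt_def by (rule lw_G00[OF unit_mat_G00])

lemma rho_unit_comm: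
  assumes "ok x" "ok y" "ok z" "ok w"
  shows "rho (unit_mat y z) (rho (unit_mat x w) u) - rho (unit_mat x w) (rho (unit_mat y z) u) =
     (if w = y then rho (unit_mat x z) u else 0) - (if z = x then rho (unit_mat y w) u else 0)"
proof -
  let ?A = "if w = y then unit_mat x z else (\<lambda>_ _. 0)"
  let ?B = "if z = x then unit_mat y w else (\<lambda>_ _. 0)"
  have fin: "?A \<in> G" "?B \<in> G"
    using assms by (auto intro!: fin_mat_Ghat fin_mat_unit fin_mat_zero)
  have "rho (unit_mat y z) (rho (unit_mat x w) u) - rho (unit_mat x w) (rho (unit_mat y z) u)
      = rho (opcomm (unit_mat y z) (unit_mat x w)) u"
    using assms by (subst rho_opcomm) (auto intro!: unit_mat_Ghat)
  also have "\<dots> = rho (oplin 1 ?A (-1) ?B) u"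
    by (simp only: opcomm_eq_oplin opcomp_unit_unit)
  also have "\<dots> = rho ?A u - rho ?B u"
    unfolding rho_oplin[OF fin] by simp
  finally show ?thesis by (simp add: rho_zero_mat)
qed

text \<open>The \<open>sl2\<close> string through \<open>v\<close> for the raising operator
  \<open>f\<close>, the lowering operator \<open>e\<close> and their bracket, the difference of the
  two diagonal units: \<open>e\<close> kills \<open>v\<close>, and each further \<open>f\<close>
  lowers the eigenvalue at \<open>x\<close> by 1 and raises that at \<open>y\<close> by 1.\<close>

lemma raise_string:
  assumes x: "ok x" and y: "ok y" and xy: "seq_gt (key y) (key x)"
  defines "f \<equiv> rho (unit_mat x y)" and "e \<equiv> rho (unit_mat y x)"
  shows "e ((f ^^ Suc n) v) = scale (of_nat (Suc n) * (wt x - wt y - of_nat n)) ((f ^^ n) v)"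
proof -
  have ne: "x \<noteq> y" using xy by (auto simp: seq_gt_def)
  note G = unit_mat_Ghat[OF x y] unit_mat_Ghat[OF y x] unit_mat_Ghat[OF x x] unit_mat_Ghat[OF y y]
  have wx: "rho (unit_mat x x) ((f ^^ n) v) = scale (wt x - of_nat n) ((f ^^ n) v)" for n
  proof (induction n)
    case 0 then show ?case by (simp add: diag_v[OF x])
  next
    case (Suc n)
    have "rho (unit_mat x x) (f ((f ^^ n) v)) = f (rho (unit_mat x x) ((f ^^ n) v)) - f ((f ^^ n) v)"
      using rho_unit_comm[OF x x x y, of "(f ^^ n) v"] ne by (simp add: f_def algebra_simps)
    also have "\<dots> = scale (wt x - of_nat n) (f ((f ^^ n) v)) - scale 1 (f ((f ^^ n) v))"
      by (simp only: Suc rho_scale[OF G(1), folded f_def] scale_one)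
    also have "\<dots> = scale (wt x - of_nat n - 1) (f ((f ^^ n) v))"
      by (simp only: scale_left_diff_distrib)
    finally show ?case by (simp add: algebra_simps)
  qed
  have wy: "rho (unit_mat y y) ((f ^^ n) v) = scale (wt y + of_nat n) ((f ^^ n) v)" for n
  proof (induction n)
    case 0 then show ?case by (simp add: diag_v[OF y])
  next
    case (Suc n)
    have "rho (unit_mat y y) (f ((f ^^ n) v)) = f (rho (unit_mat y y) ((f ^^ n) v)) + f ((f ^^ n) v)"
      using rho_unit_comm[OF x y y y, of "(f ^^ n) v"] ne by (simp add: f_def algebra_simps)
    also have "\<dots> = scale (wt y + of_nat n) (f ((f ^^ n) v)) + scale 1 (f ((f ^^ n) v))"
      by (simp only: Suc rho_scale[OF G(1), folded f_def] scale_one)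
    also have "\<dots> = scale (wt y + of_nat n + 1) (f ((f ^^ n) v))"
      by (simp only: scale_left_distrib)
    finally show ?case by (simp add: algebra_simps)
  qed
  have ef: "e (f u) = f (e u) + rho (unit_mat x x) u - rho (unit_mat y y) u" for u
    using rho_unit_comm[OF x y x y, of u] by (simp add: e_def f_def algebra_simps)
  show ?thesis
  proof (induction n)
    case 0
    have "e v = 0" unfolding e_def by (rule lower_v[OF y x xy])
    then show ?case using wx[of 0] wy[of 0]
      by (simp add: ef rho_zero[OF G(1), folded f_def] scale_left_diff_distrib)
  next
    case (Suc n)
    have "e ((f ^^ Suc (Suc n)) v) = f (e ((f ^^ Suc n) v)) + rho (unit_mat x x) ((f ^^ Suc n) v) - rho (unit_mat y y) ((f ^^ Suc n) v)"
      using ef[of "(f ^^ Suc n) v"] by simp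
    also have "\<dots> = scale (of_nat (Suc n) * (wt x - wt y - of_nat n)) ((f ^^ Suc n) v)
       + scale (wt x - of_nat (Suc n)) ((f ^^ Suc n) v) - scale (wt y + of_nat (Suc n)) ((f ^^ Suc n) v)"
      unfolding Suc wx wy by (simp add: rho_scale[OF G(1), folded f_def])
    also have "\<dots> = scale (of_nat (Suc n) * (wt x - wt y - of_nat n) + (wt x - of_nat (Suc n)) - (wt y + of_nat (Suc n))) ((f ^^ Suc n) v)"
      by (simp only: scale_left_distrib scale_left_diff_distrib)
    also have "of_nat (Suc n) * (wt x - wt y - of_nat n) + (wt x - of_nat (Suc n)) - (wt y + of_nat (Suc n))
       = of_nat (Suc (Suc n)) * (wt x - wt y - of_nat (Suc n))"
      by (simp add: algebra_simps)
    finally show ?case .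
  qed
qed

lemma raise_norm:
  assumes x: "ok x" and y: "ok y" and xy: "seq_gt (key y) (key x)"
  shows "form (rho (unit_mat x y) v) (rho (unit_mat x y) v) = wt x - wt y"
proof -
  have "form (rho (unit_mat x y) v) (rho (unit_mat x y) v) = form v (scale (wt x - wt y) v)"
    using raise_string[OF x y xy, of 0] by (simp add: rho_unit_adj[OF x y])
  moreover have "cnj (wt x - wt y) = wt x - wt y"
    using wt_real[OF x] wt_real[OF y] by (simp add: Reals_cnj_iff)
  ultimately show ?thesis by (simp add: form_scale_right norm_v)
qed

text \<open>By adjunction the string formula gives the ratio \<open>(n+1)(m-n)\<close> of
  consecutive squared norms, with \<open>m\<close> the weight difference. If \<open>m\<close> is not
  a natural number no vector of the string vanishes, and positivity forces \<open>m > n\<close> for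
  every \<open>n\<close>.\<close>

lemma wt_diff_nat:
  assumes x: "ok x" and y: "ok y" and xy: "seq_gt (key y) (key x)"
  shows "\<exists>n::nat. wt x - wt y = of_nat n"
proof (rule ccontr)
  assume no: "\<not> ?thesis"
  define f where "f = rho (unit_mat x y)"
  define N where "N n = Re (form ((f ^^ n) v) ((f ^^ n) v))" for n
  define m where "m = Re (wt x - wt y)"
  have m: "wt x - wt y = complex_of_real m"
    using wt_real[OF x] wt_real[OF y] unfolding m_def by (metis Reals_diff of_real_Re)
  have mn: "m \<noteq> real n" for n using no m by (metis of_real_of_nat_eq)
  have step: "N (Suc n) = real (Suc n) * (m - real n) * N n" for n
  proof -
    have "form ((f ^^ Suc n) v) ((f ^^ Suc n) v) = form ((f ^^ n) v) (rho (unit_mat y x) ((f ^^ Suc n) v))"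
      by (simp add: f_def rho_unit_adj[OF x y])
    also have "\<dots> = cnj (of_nat (Suc n) * (of_real m - of_nat n)) * form ((f ^^ n) v) ((f ^^ n) v)"
      unfolding f_def raise_string[OF x y xy] form_scale_right m ..
    also have "cnj (of_nat (Suc n) * (of_real m - of_nat n)) = complex_of_real (real (Suc n) * (m - real n))"
      by simp
    finally show ?thesis unfolding N_def
      by (simp only: times_complex.sel Re_complex_of_real Im_complex_of_real mult_zero_left diff_zero)
  qed
  have "N n > 0 \<and> m > real n" for n
  proof (induction n)
    case 0
    have N0: "N 0 = 1" by (simp add: N_def norm_v)
    have "N (Suc 0) \<ge> 0" unfolding N_def by (rule form_self_nonneg)
    \<comment> \<open>Positivity alone gives \<open>m \<ge> 0\<close>; that \<open>m\<close> is no
      natural number makes it strict.\<close>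
    then show ?case using step[of 0] N0 mn[of 0] by simp
  next
    case (Suc n)
    have pos: "N (Suc n) > 0" unfolding step using Suc by (intro mult_pos_pos) auto
    have "N (Suc (Suc n)) \<ge> 0" unfolding N_def by (rule form_self_nonneg)
    then have "0 \<le> real (Suc (Suc n)) * (m - real (Suc n))"
      using pos unfolding step[of "Suc n"] by (simp add: zero_le_mult_iff)
    then have "m \<ge> real (Suc n)" by (simp add: zero_le_mult_iff)
    then show ?case using pos mn[of "Suc n"] by linarith
  qed
  then show False using reals_Archimedean2[of m] by (meson less_asym)
qed

section \<open>The weight is constant far out\<close>

definition bot_vec :: "nat \<Rightarrow> tbasis" where
  "bot_vec n = (1, replicate n 1, 1)"

lemma ok_bot: "ok (bot_vec n)"
  using L_pos LF_pos by (auto simp: bot_vec_def basis_ok_def valid_lam_def valid_seq_def)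

lemma bot_vec_inj: "bot_vec n = bot_vec k \<longleftrightarrow> n = k"
  by (auto simp: bot_vec_def dest: arg_cong[where f = length])

lemma key_bot_gt: "seq_gt (key (bot_vec (Suc n))) (key (bot_vec n))"
  by (simp add: bot_vec_def seq_gt_def)

text \<open>A single non-finitary element that moves the whole chain of the \<open>bot_vec n\<close>
  one step up. That \<open>v\<close> has an image of finite norm under it bounds all weight drops
  along the chain together.\<close>

definition shift_op :: opm where
  "shift_op = opm_of L LF (Gl 1 1 [1] [])"

lemma shift_op_G: "shift_op \<in> G"
  unfolding shift_op_def using L_pos LF_pos by (intro Ghat_gen) (auto simp: valid_lam_def valid_seq_def)

lemma shift_op_to_bot: "shift_op x (bot_vec (Suc n)) = (if x = bot_vec n then 1 else 0)"
proof (cases "x = bot_vec n")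
  case True
  have "{Q. replicate n (Suc 0) = Q \<and> Suc 0 # replicate n (Suc 0) = Suc 0 # Q} = {replicate n (Suc 0)}" by auto
  then show ?thesis using ok_bot[of n] True by (simp add: shift_op_def bot_vec_def opm_of_Gl)
next
  case False
  then have "shift_op x (bot_vec (Suc n)) = 0"
    unfolding shift_op_def using opm_of_Gl_nonzeroD[of L LF 1 1 "[1]" "[]" x "bot_vec (Suc n)"]
    by (fastforce simp: bot_vec_def)
  then show ?thesis using False by simp
qed

lemma shift_op_from_bot: "shift_op (bot_vec n) y = (if y = bot_vec (Suc n) then 1 else 0)"
proof (cases "y = bot_vec (Suc n)")
  case True then show ?thesis by (simp add: shift_op_to_bot)
next
  case False
  then have "shift_op (bot_vec n) y = 0"
    unfolding shift_op_def using opm_of_Gl_nonzeroD[of L LF 1 1 "[1]" "[]" "bot_vec n" y]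
    by (fastforce simp: bot_vec_def)
  then show ?thesis using False by simp
qed

text \<open>The shift reaches \<open>bot_vec (Suc n)\<close> from \<open>bot_vec n\<close> only and
  sends \<open>bot_vec n\<close> nowhere else, so each of the two products is a single diagonal
  unit.\<close>

lemma opcomm_unit_shift:
  "opcomm (unit_mat (bot_vec (Suc n)) (bot_vec n)) shift_op =
    oplin 1 (unit_mat (bot_vec n) (bot_vec n)) (-1) (unit_mat (bot_vec (Suc n)) (bot_vec (Suc n)))"
proof -
  let ?e = "unit_mat (bot_vec (Suc n)) (bot_vec n)"
  have finX: "finite {y. shift_op x y \<noteq> 0}" for x
    using rc_mat_Ghat[OF shift_op_G] unfolding rc_mat_def by blast
  have fine: "finite {y. ?e x y \<noteq> 0}" for x
    by (rule finite_subset[of _ "{bot_vec n}"]) (simp_all add: unit_mat_def subset_iff)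
  have 1: "opcomp ?e shift_op x w = (\<Sum>y\<in>{bot_vec (Suc n)}. shift_op x y * ?e y w)" for x w
    by (rule opcomp_eq_sum) (simp_all add: finX, simp add: unit_mat_def split: if_splits)
  have 2: "opcomp shift_op ?e x w = (\<Sum>y\<in>{bot_vec n}. ?e x y * shift_op y w)" for x w
    by (rule opcomp_eq_sum) (simp_all add: fine, simp add: unit_mat_def split: if_splits)
  show ?thesis
    by (intro ext, unfold opcomm_def oplin_def 1 2)
      (simp add: shift_op_to_bot shift_op_from_bot unit_mat_def)
qed

definition bot_raise :: "nat \<Rightarrow> 'v" where
  "bot_raise n = rho (unit_mat (bot_vec n) (bot_vec (Suc n))) v"

definition gap :: "nat \<Rightarrow> complex" where
  "gap n = wt (bot_vec n) - wt (bot_vec (Suc n))"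

lemma gap_nat: "\<exists>k::nat. gap n = of_nat k"
  unfolding gap_def by (rule wt_diff_nat[OF ok_bot ok_bot key_bot_gt])

lemma bot_lower_v: "rho (unit_mat (bot_vec (Suc n)) (bot_vec n)) v = 0"
  by (rule lower_v[OF ok_bot ok_bot key_bot_gt])

text \<open>Moved across the form, the raising unit becomes a lowering one; this kills
  \<open>v\<close>, so only its bracket with the shift survives.\<close>

lemma form_shift_bot_raise: "form (rho shift_op v) (bot_raise n) = gap n"
proof -
  let ?e = "unit_mat (bot_vec (Suc n)) (bot_vec n)"
  have e: "?e \<in> G" by (rule unit_mat_Ghat[OF ok_bot ok_bot])
  have "form (rho shift_op v) (bot_raise n) = form (rho ?e (rho shift_op v)) v"
    unfolding bot_raise_def by (simp add: rho_unit_adj[OF ok_bot ok_bot])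
  also have "rho ?e (rho shift_op v) = rho (opcomm ?e shift_op) v"
    by (simp add: rho_opcomm[OF e shift_op_G] bot_lower_v rho_zero[OF shift_op_G])
  also have "\<dots> = scale (gap n) v"
    unfolding opcomm_unit_shift gap_def
    by (subst rho_oplin) (simp_all add: unit_mat_Ghat ok_bot diag_v scale_left_diff_distrib)
  finally show ?thesis by (simp add: form_scale_left norm_v)
qed

lemma form_bot_raise: "form (bot_raise n) (bot_raise k) = (if n = k then gap n else 0)"
proof -
  let ?e = "unit_mat (bot_vec (Suc k)) (bot_vec k)"
  let ?f = "unit_mat (bot_vec n) (bot_vec (Suc n))"
  have f: "?f \<in> G" by (rule unit_mat_Ghat[OF ok_bot ok_bot])
  have "form (bot_raise n) (bot_raise k) = form (rho ?e (rho ?f v)) v"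
    unfolding bot_raise_def by (simp add: rho_unit_adj[OF ok_bot ok_bot])
  also have "rho ?e (rho ?f v) = (if n = k then scale (gap n) v else 0)"
    using rho_unit_comm[OF ok_bot ok_bot ok_bot ok_bot, of "Suc k" k n "Suc n" v]
    by (simp add: bot_lower_v rho_zero[OF f] bot_vec_inj diag_v[OF ok_bot] gap_def scale_left_diff_distrib)
  finally show ?thesis by (simp add: form_scale_left norm_v)
qed

text \<open>Bessel's inequality for the orthogonal family of the vectors \<open>bot_raise n\<close>, each of which
  has the same inner product with the image of \<open>v\<close> under the shift as with itself.\<close>

lemma sum_gap_bounded: "Re (\<Sum>n<N. gap n) \<le> Re (form (rho shift_op v) (rho shift_op v))"
proof -
  define u where "u = (\<Sum>n<N. bot_raise n)"
  have gap_cnj: "cnj (gap n) = gap n" for n using gap_nat[of n] by auto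
  have 1: "form u (rho shift_op v) = (\<Sum>n<N. gap n)"
    unfolding u_def form_sum_left
    by (subst form_herm) (simp add: form_shift_bot_raise gap_cnj)
  have 2: "form (rho shift_op v) u = (\<Sum>n<N. gap n)"
    by (subst form_herm) (simp add: 1 gap_cnj)
  have "form (bot_raise n) u = gap n" if "n < N" for n
  proof -
    have "form u (bot_raise n) = (\<Sum>k<N. if k = n then gap k else 0)"
      unfolding u_def by (simp add: form_sum_left form_bot_raise)
    also have "\<dots> = gap n" using that by simp
    finally show ?thesis by (subst form_herm) (simp add: gap_cnj)
  qed
  then have 3: "form u u = (\<Sum>n<N. gap n)"
    unfolding u_def[THEN arg_cong, of "\<lambda>z. form z u"] form_sum_left by simp
  have "0 \<le> Re (form (rho shift_op v - u) (rho shift_op v - u))" by (rule form_self_nonneg)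
  then show ?thesis by (simp add: form_diff_left form_diff_right 1 2 3)
qed

text \<open>Each nonzero gap is a natural number, hence at least 1, while all partial sums stay
  below a fixed bound.\<close>

lemma finite_gaps: "finite {n. gap n \<noteq> 0}"
proof (rule ccontr)
  assume inf: "infinite {n. gap n \<noteq> 0}"
  obtain k :: "nat \<Rightarrow> nat" where k: "\<And>n. gap n = of_nat (k n)" using gap_nat by metis
  obtain C :: nat where C: "Re (form (rho shift_op v) (rho shift_op v)) < real C"
    using reals_Archimedean2 by blast
  obtain T where T: "finite T" "card T = C" "T \<subseteq> {n. gap n \<noteq> 0}"
    using infinite_arbitrarily_large[OF inf, of C] by blast
  obtain N where N: "T \<subseteq> {..<N}" using T(1) unfolding finite_nat_set_iff_bounded by blast
  have "C = (\<Sum>n\<in>T. 1)" using T by simp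
  also have "\<dots> \<le> (\<Sum>n\<in>T. k n)" using T(3) k by (intro sum_mono) (auto simp: subset_iff Suc_le_eq)
  also have "\<dots> \<le> (\<Sum>n<N. k n)" using N by (intro sum_mono2) auto
  finally have "real C \<le> Re (\<Sum>n<N. gap n)" by (simp add: k flip: of_nat_sum)
  then show False using sum_gap_bounded[of N] C by simp
qed

text \<open>The chain is cofinal in the order and its weights stabilise at \<open>c\<close> from
  length \<open>M\<close> on. A basis vector with a word longer than \<open>M\<close> lies between
  two chain members of weight \<open>c\<close>, so monotonicity pins its weight; only finitely many
  basis vectors have shorter words.\<close>

lemma wt_eventually_const:
  obtains c where "c \<in> \<real>" "\<forall>x. ok x \<longrightarrow> (\<exists>n::nat. wt x - c = of_nat n)" "finite {x. ok x \<and> wt x \<noteq> c}"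
proof -
  obtain M where M: "{n. gap n \<noteq> 0} \<subseteq> {..<M}" using finite_gaps unfolding finite_nat_set_iff_bounded by blast
  define c where "c = wt (bot_vec M)"
  have const: "wt (bot_vec (M + n)) = c" for n
  proof (induction n)
    case (Suc n)
    have "gap (M + n) = 0" using M by auto
    then show ?case using Suc by (simp add: gap_def)
  qed (simp add: c_def)
  have const': "wt (bot_vec n) = c" if "n \<ge> M" for n using const[of "n - M"] that by simp
  have above: "seq_gt (key (bot_vec n)) (key x)" if "length (fst (snd x)) < n" for n x
    using that by (cases x) (simp add: bot_vec_def seq_gt_def)
  have below: "seq_gt (key x) (key (bot_vec n))" if "n < length (fst (snd x))" for n x
    using that by (cases x) (simp add: bot_vec_def seq_gt_def)
  have nat: "\<exists>n::nat. wt x - c = of_nat n" if "ok x" for x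
  proof -
    have "length (fst (snd x)) < M + Suc (length (fst (snd x)))" by simp
    from wt_diff_nat[OF that ok_bot above[OF this]] show ?thesis unfolding const .
  qed
  have "wt x = c" if x: "ok x" and len: "\<not> length (fst (snd x)) \<le> M" for x
  proof -
    obtain n :: nat where n: "c - wt x = of_nat n"
      using wt_diff_nat[OF ok_bot x below[of M x]] len c_def by auto
    obtain m :: nat where m: "wt x - c = of_nat m" using nat[OF x] by blast
    have "of_nat (n + m) = (0::complex)" using n m by (simp flip: n m)
    then have "m = 0" by (metis add_is_0 of_nat_eq_0_iff)
    then show ?thesis using m by simp
  qed
  then have "{x. ok x \<and> wt x \<noteq> c} \<subseteq> {x. ok x \<and> length (fst (snd x)) \<le> M}" by blast
  then have "finite {x. ok x \<and> wt x \<noteq> c}" using finite_basis_length_le finite_subset by blast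
  then show ?thesis using that nat wt_real[OF ok_bot] c_def by blast
qed

end

subsection \<open>The two commuting actions\<close>

locale shifted_lw_rep = unitary_lw_rep scale L LF rho form h v
  for scale :: "complex \<Rightarrow> 'v::ab_group_add \<Rightarrow> 'v" and L LF :: nat
    and rho :: "opm \<Rightarrow> 'v \<Rightarrow> 'v" and form :: "'v \<Rightarrow> 'v \<Rightarrow> complex"
    and h :: "opm \<Rightarrow> complex" and v :: 'v +
  fixes c :: complex
  assumes c_real: "c \<in> \<real>"
    and wt_nat: "\<And>x. basis_ok L LF x \<Longrightarrow> \<exists>n::nat. wt x - c = of_nat n"
    and finite_wt: "finite {x. basis_ok L LF x \<and> wt x \<noteq> c}"
begin

definition E :: "opm \<Rightarrow> 'v \<Rightarrow> 'v" where
  "E A u = rho A u - scale (c * mtrace A) u"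

lemma E_add: "fin A \<Longrightarrow> E A (u + w) = E A u + E A w"
  by (simp add: E_def rho_add[OF fin_mat_Ghat] scale_right_distrib)

lemma E_scale: "fin A \<Longrightarrow> E A (scale a u) = scale a (E A u)"
  by (simp add: E_def rho_scale[OF fin_mat_Ghat] scale_right_diff_distrib mult.commute)

lemma E_diff: "fin A \<Longrightarrow> E A (u - w) = E A u - E A w"
  using E_add[of A "u - w" w] by simp

lemma E_oplin:
  assumes "fin A" "fin B"
  shows "E (oplin a A b B) u = scale a (E A u) + scale b (E B u)"
  unfolding E_def mtrace_oplin[OF assms] rho_oplin[OF assms[THEN fin_mat_Ghat]]
proof -
  have "scale (c * (a * mtrace A + b * mtrace B)) u = scale a (scale (c * mtrace A) u) + scale b (scale (c * mtrace B) u)"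
    by (simp add: scale_left_distrib[symmetric] distrib_left mult.left_commute)
  then show "scale a (rho A u) + scale b (rho B u) - scale (c * (a * mtrace A + b * mtrace B)) u =
    scale a (rho A u - scale (c * mtrace A) u) + scale b (rho B u - scale (c * mtrace B) u)"
    by (simp only: scale_right_diff_distrib) simp
qed

lemma E_zero_mat: "E (\<lambda>x y. 0) u = 0"
  by (simp add: E_def rho_zero_mat mtrace_def)

text \<open>\<open>E A\<close> differs from \<open>rho A\<close> by a scalar, which drops out of the
  bracket, and the bracket itself has trace 0.\<close>

lemma E_rho:
  assumes "fin A" "X \<in> G"
  shows "E A (rho X u) - rho X (E A u) = E (opcomm A X) u"
  unfolding E_def mtrace_opcomm[OF assms(1) rc_mat_Ghat[OF assms(2)]]
    rho_opcomm[OF fin_mat_Ghat[OF assms(1)] assms(2)] rho_diff[OF assms(2)] rho_scale[OF assms(2)]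
  by simp

lemma E_comm:
  assumes "fin A" "fin B"
  shows "E A (E B u) - E B (E A u) = E (opcomm A B) u"
proof -
  have "E A (E B u) - E B (E A u) = E A (rho B u) - rho B (E A u)"
    by (simp add: E_def[of B] E_diff[OF assms(1)] E_scale[OF assms(1)])
  then show ?thesis using E_rho[OF assms(1) fin_mat_Ghat[OF assms(2)]] by simp
qed

text \<open>The scalar shift respects adjoints because \<open>c\<close> is real.\<close>

lemma E_adj:
  assumes "fin A"
  shows "form (E A u) w = form u (E (madj A) w)"
  using assms
proof (induction rule: fin_mat_induct)
  case zero
  have "madj (\<lambda>x y. 0) = (\<lambda>x y. 0)" by (simp add: madj_def)
  then show ?case by (simp add: E_zero_mat)
next
  case (unit x y)
  have "cnj c = c" using c_real by (simp add: Reals_cnj_iff)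
  then show ?case
    unfolding madj_unit E_def form_diff_left form_diff_right rho_unit_adj[OF unit(2,3)]
    by (simp add: form_scale_left form_scale_right mtrace_unit)
next
  case (oplin a b B C)
  then show ?case
    by (simp add: madj_oplin E_oplin fin_mat_madj form_add_left form_add_right form_scale_left form_scale_right)
qed

definition supp0 :: "tbasis set" where
  "supp0 = {x. ok x \<and> wt x \<noteq> c}"

lemma E_lower_v: "ok x \<Longrightarrow> ok y \<Longrightarrow> seq_gt (key x) (key y) \<Longrightarrow> E (unit_mat x y) v = 0"
  by (auto simp: E_def lower_v mtrace_unit seq_gt_def)

lemma E_diag_v: "ok x \<Longrightarrow> E (unit_mat x x) v = scale (wt x - c) v"
  by (simp add: E_def diag_v mtrace_unit scale_left_diff_distrib)

text \<open>The weight of \<open>y\<close> lies between \<open>c\<close> and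
  \<open>wt x = c\<close>, so the squared norm \<open>wt x - wt y\<close> of the raised vector is
  0.\<close>

lemma E_raise_v:
  assumes "ok x" "ok y" "seq_gt (key y) (key x)" "wt x = c"
  shows "E (unit_mat x y) v = 0"
proof -
  have ne: "x \<noteq> y" using assms(3) by (auto simp: seq_gt_def)
  obtain n :: nat where n: "wt x - wt y = of_nat n" using wt_diff_nat[OF assms(1-3)] by blast
  obtain m :: nat where m: "wt y - c = of_nat m" using wt_nat[OF assms(2)] by blast
  have "of_nat (n + m) = (0::complex)" using assms(4) by (simp flip: n m)
  then have "n = 0" by (metis add_is_0 of_nat_eq_0_iff)
  then have "form (rho (unit_mat x y) v) (rho (unit_mat x y) v) = 0"
    using raise_norm[OF assms(1-3)] n by simp
  then show ?thesis using ne by (simp add: E_def form_self_zero mtrace_unit)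
qed

text \<open>\<open>carries F u\<close>: the shifted action \<open>E\<close> on \<open>u\<close> only sees the columns in \<open>F\<close>. Every vector is
  carried by a finite set, which makes \<open>D X\<close> below well defined for infinite matrices.\<close>

definition carries :: "tbasis set \<Rightarrow> 'v \<Rightarrow> bool" where
  "carries F u \<longleftrightarrow> (\<forall>A. fin A \<longrightarrow> (\<forall>x\<in>F. \<forall>y. A x y = 0) \<longrightarrow> E A u = 0)"

lemma carries_mono: "carries F u \<Longrightarrow> F \<subseteq> F' \<Longrightarrow> carries F' u"
  unfolding carries_def by blast

text \<open>For an input of weight \<open>c\<close>, a lowering unit kills \<open>v\<close>, the
  diagonal one acts by \<open>wt x - c = 0\<close>, and a raising one gives a vector of norm
  0.\<close>

lemma carries_v: "carries supp0 v"
  unfolding carries_def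
proof (intro allI impI)
  fix A assume A: "fin A" and van: "\<forall>x\<in>supp0. \<forall>y. A x y = 0"
  show "E A v = 0" using A
  proof (induction rule: fin_mat_induct)
    case zero show ?case by (rule E_zero_mat)
  next
    case (unit x y)
    have c: "wt x = c" using unit van unfolding supp0_def by blast
    consider "seq_gt (key x) (key y)" | "x = y" | "seq_gt (key y) (key x)"
      using seq_gt_total key_inj by blast
    then show ?case
      using E_lower_v[OF unit(2,3)] E_diag_v[OF unit(2)] E_raise_v[OF unit(2,3) _ c] c by cases auto
  next
    case (oplin a b B C) then show ?case by (simp add: E_oplin)
  qed
qed

lemma carries_lin:
  assumes "carries F u" "carries F w"
  shows "carries F (scale a u + scale b w)"
  using assms unfolding carries_def by (simp add: E_add E_scale)

text \<open>\<open>E A (rho X u)\<close> equals \<open>rho X (E A u)\<close> plus the action of the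
  bracket of \<open>A\<close> and \<open>X\<close>. If \<open>A\<close> vanishes on \<open>F\<close>
  and on the image of \<open>F\<close> under \<open>X\<close>, then the bracket vanishes on
  \<open>F\<close>, so both terms are 0.\<close>

lemma carries_rho:
  assumes "X \<in> G" "carries F u" "F \<subseteq> F'" "\<And>x y. x \<in> F \<Longrightarrow> X x y \<noteq> 0 \<Longrightarrow> y \<in> F'"
  shows "carries F' (rho X u)"
  unfolding carries_def
proof (intro allI impI)
  fix A assume A: "fin A" and van: "\<forall>x\<in>F'. \<forall>y. A x y = 0"
  have "E A u = 0" using A van assms(2,3) unfolding carries_def by blast
  moreover have "opcomm A X x y = 0" if "x \<in> F" for x y
    by (rule opcomm_vanish[OF assms(3) _ _ that]) (use assms(4) van in blast)+
  then have "E (opcomm A X) u = 0"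
    using assms(2) fin_mat_opcomm[OF A rc_mat_Ghat[OF assms(1)]] unfolding carries_def by blast
  ultimately show "E A (rho X u) = 0"
    using E_rho[OF A assms(1), of u] rho_zero[OF assms(1)] by simp
qed

lemma finite_image_rc: "rc X \<Longrightarrow> finite F \<Longrightarrow> finite {y. \<exists>x\<in>F. X x y \<noteq> 0}"
proof -
  assume "rc X" "finite F"
  then have "finite (\<Union>x\<in>F. {y. X x y \<noteq> 0})" unfolding rc_mat_def by blast
  moreover have "{y. \<exists>x\<in>F. X x y \<noteq> 0} = (\<Union>x\<in>F. {y. X x y \<noteq> 0})" by blast
  ultimately show ?thesis by simp
qed

text \<open>The vectors with a finite carrier form an invariant subspace containing
  \<open>v\<close>, and \<open>v\<close> generates everything.\<close>

lemma ex_carrier: "\<exists>F. finite F \<and> carries F u"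
proof -
  let ?U = "{u. \<exists>F. finite F \<and> carries F u}"
  have v: "v \<in> ?U"
    by (intro CollectI exI[of _ supp0] conjI carries_v) (simp add: supp0_def finite_wt)
  have lin: "scale a u + scale b w \<in> ?U" if "u \<in> ?U" "w \<in> ?U" for a b u w
  proof -
    from that obtain F F' where F: "finite F" "carries F u" "finite F'" "carries F' w"
      by (elim CollectE exE conjE)
    have "carries (F \<union> F') (scale a u + scale b w)"
      by (rule carries_lin; rule carries_mono[OF F(2)] carries_mono[OF F(4)]; blast)
    moreover have "finite (F \<union> F')" using F by simp
    ultimately show ?thesis by (intro CollectI exI conjI)
  qed
  have "subspace ?U"
    unfolding subspace_def
  proof (intro conjI ballI allI)
    show "0 \<in> ?U" using lin[OF v v, of 0 0] by (simp only: scale_zero_left add_0)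
    show "u + w \<in> ?U" if "u \<in> ?U" "w \<in> ?U" for u w
      using lin[OF that, of 1 1] by (simp only: scale_one)
    show "scale a u \<in> ?U" if "u \<in> ?U" for a u
      using lin[OF that that, of a 0] by (simp only: scale_zero_left add_0_right)
  qed
  moreover have "\<forall>X\<in>G. \<forall>u\<in>?U. rho X u \<in> ?U"
  proof (intro ballI)
    fix X u assume that: "X \<in> G" "u \<in> ?U"
    then obtain F where F: "finite F" "carries F u" by blast
    have "carries (F \<union> {y. \<exists>x\<in>F. X x y \<noteq> 0}) (rho X u)"
      by (rule carries_rho[OF that(1) F(2)]) blast+
    moreover have "finite (F \<union> {y. \<exists>x\<in>F. X x y \<noteq> 0})"
      using F(1) finite_image_rc[OF rc_mat_Ghat[OF that(1)] F(1)] by simp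
    ultimately show "rho X u \<in> ?U" by (intro CollectI exI conjI)
  qed
  ultimately have "?U = UNIV"
    by (intro lw_generates[OF v]) (simp only: invariant_subspace_def simp_thms)
  then have "u \<in> ?U" by (simp only: UNIV_I)
  then show ?thesis by (rule CollectD)
qed

lemma ex_common_carrier:
  assumes "finite S"
  obtains F where "finite F" "\<And>u. u \<in> S \<Longrightarrow> carries F u"
proof -
  have "\<exists>F. finite F \<and> (\<forall>u\<in>S. carries F u)"
    using assms
  proof (induction S rule: finite_induct)
    case (insert u S)
    then obtain F where "finite F" "\<forall>u\<in>S. carries F u" by blast
    moreover obtain F' where "finite F'" "carries F' u" using ex_carrier by blast
    ultimately show ?case
      by (intro exI[of _ "F \<union> F'"]) (auto intro: carries_mono)
  qed blast
  then show ?thesis using that by blast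
qed

lemma E_mrestr:
  assumes "fin A" "carries F u"
  shows "E (mrestr A F) u = E A u"
proof -
  let ?B = "mrestr A (- F)"
  have "A = oplin 1 (mrestr A F) 1 ?B" by (intro ext) (simp add: oplin_def mrestr_def)
  then have "E A u = E (oplin 1 (mrestr A F) 1 ?B) u" by simp
  also have "\<dots> = E (mrestr A F) u + E ?B u"
    using assms by (simp add: E_oplin fin_mat_mrestr_fin)
  also have "E ?B u = 0"
  proof -
    have "\<forall>x\<in>F. \<forall>y. ?B x y = 0" by (simp add: mrestr_def)
    then show ?thesis using assms(2) fin_mat_mrestr_fin[OF assms(1)] unfolding carries_def by blast
  qed
  finally show ?thesis by simp
qed

definition D :: "opm \<Rightarrow> 'v \<Rightarrow> 'v" where
  "D X u = E (mrestr X (SOME F. finite F \<and> carries F u)) u"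

text \<open>The chosen carrier is immaterial: since \<open>F\<close> and \<open>F1\<close> both
  carry \<open>u\<close>, truncating to either agrees with truncating to the intersection.\<close>

lemma D_eq:
  assumes "rc X" "finite F" "carries F u"
  shows "D X u = E (mrestr X F) u"
proof -
  define F1 where "F1 = (SOME F. finite F \<and> carries F u)"
  have F1: "finite F1" "carries F1 u"
    using someI_ex[OF ex_carrier, of u] unfolding F1_def by blast+
  have "E (mrestr X F1) u = E (mrestr X (F1 \<inter> F)) u"
    using E_mrestr[OF fin_mat_mrestr[OF assms(1) F1(1)] assms(3)] by (simp add: mrestr_mrestr)
  also have "\<dots> = E (mrestr X F) u"
    using E_mrestr[OF fin_mat_mrestr[OF assms(1,2)] F1(2)] by (simp add: mrestr_mrestr Int_commute)
  finally show ?thesis by (simp add: D_def F1_def)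
qed

lemma D_fin:
  assumes "fin A"
  shows "D A u = E A u"
proof -
  obtain F where F: "finite F" "carries F u" using ex_carrier by blast
  show ?thesis using D_eq[OF rc_mat_fin[OF assms] F] E_mrestr[OF assms F(2)] by simp
qed

lemma D_lin:
  assumes "rc X"
  shows "D X (scale a u + scale b w) = scale a (D X u) + scale b (D X w)"
proof -
  obtain F where F: "finite F" "\<And>z. z \<in> {u, w} \<Longrightarrow> carries F z"
    using ex_common_carrier[of "{u, w}"] by blast
  then have cu: "carries F u" "carries F w" by blast+
  note fin = fin_mat_mrestr[OF assms F(1)]
  show ?thesis
    using D_eq[OF assms F(1) cu(1)] D_eq[OF assms F(1) cu(2)]
      D_eq[OF assms F(1) carries_lin[OF cu]] by (simp add: E_add[OF fin] E_scale[OF fin])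
qed

lemma D_add: "rc X \<Longrightarrow> D X (u + w) = D X u + D X w"
  using D_lin[of X 1 u 1 w] by simp

lemma D_scale: "rc X \<Longrightarrow> D X (scale a u) = scale a (D X u)"
  using D_lin[of X a u 0 u] by simp

lemma D_diff: "rc X \<Longrightarrow> D X (u - w) = D X u - D X w"
  using D_add[of X "u - w" w] by simp

lemma D_oplin:
  assumes "rc X" "rc Y"
  shows "D (oplin a X b Y) u = scale a (D X u) + scale b (D Y u)"
proof -
  obtain F where F: "finite F" "carries F u" using ex_carrier by blast
  show ?thesis
    unfolding D_eq[OF assms(1) F] D_eq[OF assms(2) F] D_eq[OF rc_mat_oplin[OF assms] F] mrestr_oplin
    by (rule E_oplin[OF fin_mat_mrestr[OF assms(1) F(1)] fin_mat_mrestr[OF assms(2) F(1)]])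
qed

text \<open>Passage from \<open>E_rho\<close> to infinite \<open>X\<close>: the truncation set must
  be large enough for \<open>u\<close> and \<open>rho Y u\<close>, and also for the bracket of the
  truncation to agree with the true bracket on a carrier of \<open>u\<close>.\<close>

lemma D_rho:
  assumes X: "rc X" and Y: "Y \<in> G"
  shows "D X (rho Y u) - rho Y (D X u) = D (opcomm X Y) u"
proof -
  obtain F where F: "finite F" "\<And>z. z \<in> {u, rho Y u} \<Longrightarrow> carries F z"
    using ex_common_carrier[of "{u, rho Y u}"] by blast
  \<comment> \<open>The carrier together with its images under \<open>X\<close> and
    \<open>Y\<close>, as \<open>opcomm_mrestr\<close> requires.\<close>
  define F' where "F' = F \<union> {y. \<exists>x\<in>F. X x y \<noteq> 0} \<union> {y. \<exists>x\<in>F. Y x y \<noteq> 0}"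
  have rcY: "rc Y" by (rule rc_mat_Ghat[OF Y])
  have F': "finite F'" "F \<subseteq> F'" unfolding F'_def using F(1) finite_image_rc[OF X] finite_image_rc[OF rcY] by auto
  have c: "carries F u" "carries F' u" "carries F' (rho Y u)" using F(2) carries_mono F'(2) by blast+
  have fin: "fin (mrestr X F')" by (rule fin_mat_mrestr[OF X F'(1)])
  have "D X (rho Y u) - rho Y (D X u) = E (mrestr X F') (rho Y u) - rho Y (E (mrestr X F') u)"
    unfolding D_eq[OF X F'(1) c(2)] D_eq[OF X F'(1) c(3)] ..
  also have "\<dots> = E (opcomm (mrestr X F') Y) u" by (rule E_rho[OF fin Y])
  also have "\<dots> = E (mrestr (opcomm (mrestr X F') Y) F) u"
    by (rule E_mrestr[OF fin_mat_opcomm[OF fin rcY] c(1), symmetric])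
  also have "mrestr (opcomm (mrestr X F') Y) F = mrestr (opcomm X Y) F"
    by (rule opcomm_mrestr(2)[OF F'(2)]) (unfold F'_def, blast)
  also have "E (mrestr (opcomm X Y) F) u = D (opcomm X Y) u"
    by (rule D_eq[OF rc_mat_opcomm[OF X rcY] F(1) c(1), symmetric])
  finally show ?thesis .
qed

lemma D_comm:
  assumes X: "rc X" and Y: "rc Y"
  shows "D X (D Y u) - D Y (D X u) = D (opcomm X Y) u"
proof -
  obtain F where F: "finite F" "\<And>z. z \<in> {u, D X u, D Y u} \<Longrightarrow> carries F z"
    using ex_common_carrier[of "{u, D X u, D Y u}"] by blast
  define F' where "F' = F \<union> {y. \<exists>x\<in>F. X x y \<noteq> 0} \<union> {y. \<exists>x\<in>F. Y x y \<noteq> 0}"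
  have F': "finite F'" "F \<subseteq> F'" unfolding F'_def using F(1) finite_image_rc[OF X] finite_image_rc[OF Y] by auto
  have c: "carries F u" "carries F' u" "carries F' (D X u)" "carries F' (D Y u)"
    using F(2) carries_mono F'(2) by blast+
  have fin: "fin (mrestr X F')" "fin (mrestr Y F')" using fin_mat_mrestr X Y F'(1) by blast+
  have "D X (D Y u) - D Y (D X u) = E (mrestr X F') (E (mrestr Y F') u) - E (mrestr Y F') (E (mrestr X F') u)"
    unfolding D_eq[OF X F'(1) c(4)] D_eq[OF Y F'(1) c(3)] unfolding D_eq[OF X F'(1) c(2)] D_eq[OF Y F'(1) c(2)] ..
  also have "\<dots> = E (opcomm (mrestr X F') (mrestr Y F')) u" by (rule E_comm[OF fin])
  also have "\<dots> = E (mrestr (opcomm (mrestr X F') (mrestr Y F')) F) u"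
    by (rule E_mrestr[OF fin_mat_opcomm[OF fin(1) rc_mat_fin[OF fin(2)]] c(1), symmetric])
  also have "mrestr (opcomm (mrestr X F') (mrestr Y F')) F = mrestr (opcomm X Y) F"
    by (rule opcomm_mrestr(1)[OF F'(2)]) (unfold F'_def, blast)
  also have "E (mrestr (opcomm X Y) F) u = D (opcomm X Y) u"
    by (rule D_eq[OF rc_mat_opcomm[OF X Y] F(1) c(1), symmetric])
  finally show ?thesis .
qed

text \<open>The input truncations of \<open>X\<close> and of its transpose are not adjoint to each
  other. Cutting to \<open>F\<close> on both sides makes them so, and the second cut is free because
  \<open>F\<close> carries both \<open>u\<close> and \<open>w\<close>.\<close>

lemma D_adj:
  assumes g: "valid_gen L LF g"
  shows "form (D (opm_of L LF g) u) w = form u (D (opm_of L LF (omega_gen g)) w)"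
proof -
  let ?X = "opm_of L LF g" and ?Y = "opm_of L LF (omega_gen g)"
  have g': "valid_gen L LF (omega_gen g)" using g by (cases g) auto
  have X: "rc ?X" and Y: "rc ?Y" using rc_mat_opm_of g g' by blast+
  obtain F where F: "finite F" "\<And>z. z \<in> {u, w} \<Longrightarrow> carries F z"
    using ex_common_carrier[of "{u, w}"] by blast
  then have cu: "carries F u" and cw: "carries F w" by blast+
  have finX: "fin (mrestr ?X F)" and finY: "fin (mrestr ?Y F)" using fin_mat_mrestr X Y F(1) by blast+
  \<comment> \<open>Both sides are the block of \<open>?X\<close> with input and output in
    \<open>F\<close>; realness of the entries removes the conjugation.\<close>
  have eq: "madj (mrestr (madj (mrestr ?X F)) F) = mrestr (madj (mrestr ?Y F)) F"
    using opm_of_real[of L LF g] by (intro ext) (simp add: madj_def mrestr_def opm_of_omega[OF g] Reals_cnj_iff)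
  have madj2: "madj (madj A) = A" for A by (simp add: madj_def)
  have "form (D ?X u) w = form u (E (madj (mrestr ?X F)) w)"
    unfolding D_eq[OF X F(1) cu] by (rule E_adj[OF finX])
  also have "\<dots> = form u (E (mrestr (madj (mrestr ?X F)) F) w)"
    using E_mrestr[OF fin_mat_madj[OF finX] cw] by simp
  also have "\<dots> = form (E (mrestr (madj (mrestr ?Y F)) F) u) w"
    using E_adj[OF fin_mat_madj[OF fin_mat_mrestr_fin[OF fin_mat_madj[OF finX]]], of F u w]
    unfolding madj2 unfolding eq by (rule sym)
  also have "\<dots> = form (E (madj (mrestr ?Y F)) u) w"
    using E_mrestr[OF fin_mat_madj[OF finY] cu] by simp
  also have "\<dots> = form u (E (mrestr ?Y F) w)"
    using E_adj[OF fin_mat_madj[OF finY]] by (simp add: madj2)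
  finally show ?thesis unfolding D_eq[OF Y F(1) cw] .
qed

section \<open>The complementary action\<close>

definition R :: "opm \<Rightarrow> 'v \<Rightarrow> 'v" where
  "R X u = rho X u - D X u"

lemma R_add: "X \<in> G \<Longrightarrow> R X (u + w) = R X u + R X w"
  by (simp add: R_def rho_add D_add rc_mat_Ghat)

lemma R_scale: "X \<in> G \<Longrightarrow> R X (scale a u) = scale a (R X u)"
  by (simp add: R_def rho_scale D_scale rc_mat_Ghat scale_right_diff_distrib)

lemma R_oplin: "X \<in> G \<Longrightarrow> Y \<in> G \<Longrightarrow> R (oplin a X b Y) u = scale a (R X u) + scale b (R Y u)"
  by (simp add: R_def rho_oplin D_oplin rc_mat_Ghat scale_right_diff_distrib)

text \<open>Of the four brackets of \<open>rho\<close> and \<open>D\<close>, the two mixed ones and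
  the pure \<open>D\<close> one each contribute plus or minus the same \<open>D\<close> term;
  together they leave it with coefficient -1.\<close>

lemma R_comm:
  assumes X: "X \<in> G" and Y: "Y \<in> G"
  shows "R (opcomm X Y) u = R X (R Y u) - R Y (R X u)"
proof -
  note rcX = rc_mat_Ghat[OF X] and rcY = rc_mat_Ghat[OF Y]
  have "R X (R Y u) - R Y (R X u) = (rho X (rho Y u) - rho Y (rho X u))
      + (D Y (rho X u) - rho X (D Y u)) - (D X (rho Y u) - rho Y (D X u)) + (D X (D Y u) - D Y (D X u))"
    by (simp add: R_def rho_diff[OF X] rho_diff[OF Y] D_diff[OF rcX] D_diff[OF rcY])
  also have "\<dots> = rho (opcomm X Y) u + D (opcomm Y X) u"
    by (simp add: rho_opcomm[OF X Y] D_rho[OF rcX Y] D_rho[OF rcY X] D_comm[OF rcX rcY])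
  also have "D (opcomm Y X) u = - D (opcomm X Y) u"
    by (simp flip: D_comm[OF rcX rcY] D_comm[OF rcY rcX])
  finally show ?thesis by (simp add: R_def)
qed

text \<open>\<open>E A\<close> has the same bracket with \<open>rho X\<close> as with
  \<open>D X\<close>, namely the action of the finitary bracket of \<open>A\<close> and
  \<open>X\<close>.\<close>

lemma E_R_commute:
  assumes A: "fin A" and X: "X \<in> G"
  shows "E A (R X u) = R X (E A u)"
proof -
  note rcX = rc_mat_Ghat[OF X] and rcA = rc_mat_fin[OF A]
  have "E A (rho X u) - rho X (E A u) = E A (D X u) - D X (E A u)"
    using E_rho[OF A X] D_comm[OF rcA rcX] D_fin[OF A] D_fin[OF fin_mat_opcomm[OF A rcX]] by simp
  then show ?thesis by (simp add: R_def E_diff[OF A] algebra_simps)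
qed

lemma R_adj:
  assumes "valid_gen L LF g"
  shows "form (R (opm_of L LF g) u) w = form u (R (opm_of L LF (omega_gen g)) w)"
  by (simp add: R_def form_diff_left form_diff_right form_omega[OF assms] D_adj[OF assms])

lemma R_sl_inf:
  assumes "X \<in> sl_inf L LF"
  shows "R X u = 0"
  using sl_inf_traceless[OF assms] D_fin[of X u] by (simp add: R_def E_def)

section \<open>Lowest weights of the two actions\<close>

definition h1 :: "opm \<Rightarrow> complex" where
  "h1 H = (\<Sum>x\<in>supp0. H x x * (wt x - c))"

lemma finite_supp0: "finite supp0"
  using finite_wt by (simp add: supp0_def)

lemma h1_oplin: "h1 (oplin a H b K) = a * h1 H + b * h1 K"
  by (simp add: h1_def oplin_def sum_distrib_left sum.distrib distrib_right mult.assoc)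

lemma D_Gminus_v:
  assumes "X \<in> Gminus L LF"
  shows "D X v = 0"
proof -
  have X: "rc X" by (rule rc_mat_Ghat[OF Gminus_Ghat[OF assms]])
  have "E (mrestr X supp0) v = 0" using fin_mat_mrestr[OF X finite_supp0]
  proof (induction rule: fin_mat_induct)
    case zero show ?case by (rule E_zero_mat)
  next
    case (unit x y)
    then have "X x y \<noteq> 0" by (auto simp: mrestr_def split: if_splits)
    then show ?case using E_lower_v[OF unit(2,3)] Gminus_lowers[OF assms] by blast
  next
    case (oplin a b B C) then show ?case by (simp add: E_oplin)
  qed
  then show ?thesis by (simp add: D_eq[OF X finite_supp0 carries_v])
qed

text \<open>The truncation to the carrier \<open>supp0\<close> of \<open>v\<close> is a finite sum
  of diagonal units, each acting by \<open>wt x - c\<close>; this is the origin of the formula for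
  \<open>h1\<close>.\<close>

lemma D_G00_v:
  assumes "X \<in> G00 L LF"
  shows "D X v = scale (h1 X) v"
proof -
  have X: "rc X" by (rule rc_mat_Ghat[OF G00_Ghat[OF assms]])
  have "E (mrestr X supp0) v = scale (h1 (mrestr X supp0)) v" using fin_mat_mrestr[OF X finite_supp0]
  proof (induction rule: fin_mat_induct)
    case zero show ?case by (simp add: E_zero_mat h1_def)
  next
    case (unit x y)
    then have "X x y \<noteq> 0" "x \<in> supp0" by (auto simp: mrestr_def split: if_splits)
    then have xy: "x = y" "x \<in> supp0" using G00_diagonal[OF assms] by blast+
    have "h1 (unit_mat x x) = (\<Sum>z\<in>supp0. if z = x then wt z - c else 0)"
      unfolding h1_def by (intro sum.cong refl) (simp add: unit_mat_def)
    also have "\<dots> = wt x - c" using finite_supp0 xy(2) by simp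
    finally show ?case using xy(1) E_diag_v[OF unit(2)] by simp
  next
    case (oplin a b B C) then show ?case by (simp add: E_oplin h1_oplin scale_left_distrib)
  qed
  moreover have "h1 (mrestr X supp0) = h1 X" unfolding h1_def by (intro sum.cong refl) (simp add: mrestr_def)
  ultimately show ?thesis by (simp add: D_eq[OF X finite_supp0 carries_v])
qed

lemma h1_gen_real: "h1 (opm_of L LF g) \<in> \<real>"
  unfolding h1_def using opm_of_real wt_real c_real unfolding supp0_def
  by (intro sum_in_Reals Reals_mult Reals_diff) blast+

lemma h1_functional: "lowest_weight_functional L LF h1"
  using h1_oplin h1_gen_real by (simp add: lowest_weight_functional_def)

lemma h2_functional: "lowest_weight_functional L LF (\<lambda>H. h H - h1 H)"
  using lw_functional h1_functional by (simp add: lowest_weight_functional_def algebra_simps)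

lemma R_Gminus_v: "X \<in> Gminus L LF \<Longrightarrow> R X v = 0"
  by (simp add: R_def lw_Gminus D_Gminus_v)

lemma R_G00_v: "X \<in> G00 L LF \<Longrightarrow> R X v = scale (h X - h1 X) v"
  by (simp add: R_def lw_G00 D_G00_v scale_left_diff_distrib)

subsection \<open>Factorisation of the form\<close>

text \<open>The filtration, by number of factors, of the operator algebra generated by all
  \<open>E A\<close>. Words are maps rather than formal expressions, and \<open>n\<close> is only an
  upper bound for the number of factors.\<close>

inductive word :: "nat \<Rightarrow> ('v \<Rightarrow> 'v) \<Rightarrow> bool" where
  word_scal: "word n (\<lambda>u. scale a u)"
| word_step: "word n d \<Longrightarrow> fin A \<Longrightarrow> word (Suc n) (\<lambda>u. E A (d u))"
| word_add: "word n d \<Longrightarrow> word n d' \<Longrightarrow> word n (\<lambda>u. d u + d' u)"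
| word_Suc: "word n d \<Longrightarrow> word (Suc n) d"

lemma word_mono: "word n d \<Longrightarrow> n \<le> m \<Longrightarrow> word m d"
  by (induction m) (auto simp: le_Suc_eq intro: word_Suc)

lemma word_lin: "word n d \<Longrightarrow> d (scale a u + scale b w) = scale a (d u) + scale b (d w)"
proof (induction rule: word.induct)
  case (word_scal n a')
  then show ?case by (simp add: scale_right_distrib mult.commute)
next
  case (word_step n d A)
  then show ?case by (simp add: E_add E_scale)
next
  case (word_add n d d')
  then show ?case by (simp add: scale_right_distrib algebra_simps)
qed

lemma word_scale_arg: "word n d \<Longrightarrow> d (scale a u) = scale a (d u)"
  using word_lin[of n d a u 0 u] by simp

lemma word_scale: "word n d \<Longrightarrow> word n (\<lambda>u. scale a (d u))"
proof (induction rule: word.induct)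
  case (word_scal n b)
  have "word n (\<lambda>u. scale (a * b) u)" by (rule word.word_scal)
  then show ?case by simp
next
  case (word_step n d A)
  have "(\<lambda>u. scale a (E A (d u))) = (\<lambda>u. E A (scale a (d u)))" using word_step by (simp add: E_scale)
  then show ?case using word.word_step[OF word_step(3,2)] by simp
next
  case (word_add n d d')
  then show ?case using word.word_add[OF word_add(3,4)] by (simp add: scale_right_distrib)
next
  case (word_Suc n d) then show ?case using word.word_Suc by blast
qed

lemma word_comp:
  assumes "word m d'"
  shows "word n d \<Longrightarrow> word (n + m) (\<lambda>u. d (d' u))"
proof (induction rule: word.induct)
  case (word_scal n b)
  show ?case by (rule word_mono[OF word_scale[OF assms]]) simp
next
  case (word_step n d A) then show ?case using word.word_step by simp
next
  case (word_add n d d') then show ?case using word.word_add by simp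
next
  case (word_Suc n d) then show ?case using word.word_Suc by simp
qed

text \<open>Bracketing with \<open>E B\<close> acts as a derivation and turns one factor
  \<open>E A\<close> into another one, so the bound on the number of factors is kept. Induction on
  that number rests on this.\<close>

lemma word_commutator:
  assumes B: "fin B"
  shows "word n d \<Longrightarrow> \<exists>d'. word n d' \<and> (\<forall>u. E B (d u) = d (E B u) + d' u)"
proof (induction rule: word.induct)
  case (word_scal n a)
  have "\<forall>u. E B (scale a u) = scale a (E B u) + scale 0 u" using B by (simp add: E_scale)
  then show ?case using word.word_scal[of n 0] by blast
next
  case (word_step n d A)
  then obtain d1 where d1: "word n d1" "\<And>u. E B (d u) = d (E B u) + d1 u" by blast
  note fin = fin_mat_opcomm[OF B rc_mat_fin[OF word_step(2)]]
  let ?d' = "\<lambda>u. E A (d1 u) + E (opcomm B A) (d u)"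
  have "word (Suc n) ?d'"
    by (intro word.word_add word.word_step d1 word_step fin)
  moreover have "E B (E A (d u)) = E A (d (E B u)) + ?d' u" for u
  proof -
    have "E B (E A (d u)) = E A (E B (d u)) + E (opcomm B A) (d u)"
      using E_comm[OF B word_step(2), of "d u"] by (simp add: algebra_simps)
    then show ?thesis by (simp add: d1(2) E_add[OF word_step(2)] add.assoc)
  qed
  ultimately show ?case by blast
next
  case (word_add n d d')
  from word_add(3) obtain d1 where d1: "word n d1" "\<And>u. E B (d u) = d (E B u) + d1 u" by blast
  from word_add(4) obtain d2 where d2: "word n d2" "\<And>u. E B (d' u) = d' (E B u) + d2 u" by blast
  have "\<forall>u. E B (d u + d' u) = d (E B u) + d' (E B u) + (d1 u + d2 u)"
    by (simp add: E_add[OF B] d1 d2 algebra_simps)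
  then show ?case using word.word_add[OF d1(1) d2(1)] by blast
next
  case (word_Suc n d)
  then show ?case using word.word_Suc by blast
qed

lemma word_R: 
  assumes X: "X \<in> G"
  shows "word n d \<Longrightarrow> d (R X u) = R X (d u)"
  by (induction rule: word.induct) (simp_all add: R_scale[OF X] R_add[OF X] E_R_commute X)

lemma word_adj: "word n d \<Longrightarrow> \<exists>d'. word n d' \<and> (\<forall>u w. form (d u) w = form u (d' w))"
proof (induction rule: word.induct)
  case (word_scal n a)
  have "\<forall>u w. form (scale a u) w = form u (scale (cnj a) w)"
    by (simp add: form_scale_left form_scale_right)
  then show ?case using word.word_scal[of n "cnj a"] by blast
next
  case (word_step n d A)
  then obtain d1 where d1: "word n d1" "\<And>u w. form (d u) w = form u (d1 w)" by blast
  have "word 1 (\<lambda>u. E (madj A) (scale 1 u))"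
    using word.word_step[OF word.word_scal fin_mat_madj[OF word_step(2)], of 0 1] by simp
  then have "word (n + 1) (\<lambda>u. d1 (E (madj A) (scale 1 u)))" by (rule word_comp[OF _ d1(1)])
  then have "word (Suc n) (\<lambda>u. d1 (E (madj A) u))" by simp
  moreover have "\<forall>u w. form (E A (d u)) w = form u (d1 (E (madj A) w))"
    by (simp add: E_adj[OF word_step(2)] d1(2))
  ultimately show ?case by blast
next
  case (word_add n d d')
  from word_add(3) obtain d1 where d1: "word n d1" "\<And>u w. form (d u) w = form u (d1 w)" by blast
  from word_add(4) obtain d2 where d2: "word n d2" "\<And>u w. form (d' u) w = form u (d2 w)" by blast
  have "\<forall>u w. form (d u + d' u) w = form u (d1 w + d2 w)"
    by (simp add: form_add_left form_add_right d1 d2)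
  then show ?case using word.word_add[OF d1(1) d2(1)] by blast
next
  case (word_Suc n d)
  then show ?case using word.word_Suc by blast
qed

section \<open>The two submodules generated by the lowest weight vector\<close>

inductive_set W2 :: "'v set" where
  W2_v: "v \<in> W2"
| W2_lin: "u \<in> W2 \<Longrightarrow> w \<in> W2 \<Longrightarrow> scale a u + scale b w \<in> W2"
| W2_R: "u \<in> W2 \<Longrightarrow> X \<in> G \<Longrightarrow> R X u \<in> W2"

text \<open>Words use finitary matrices only, yet this set is stable under every \<open>D X\<close>:
  on a given vector \<open>D X\<close> is \<open>E\<close> of a finite truncation.\<close>

definition W1 :: "'v set" where
  "W1 = {d v | d n. word n d}"

lemma W1_I: "word n d \<Longrightarrow> d v \<in> W1"
  unfolding W1_def by blast

lemma W1_E: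
  assumes "x \<in> W1"
  obtains d n where "word n d" "x = d v"
  using assms unfolding W1_def by blast

lemma W1_v: "v \<in> W1"
  using W1_I[OF word_scal[of 0 1]] by simp

lemma W1_lin:
  assumes "x \<in> W1" "y \<in> W1"
  shows "scale a x + scale b y \<in> W1"
proof -
  obtain d n where d: "word n d" "x = d v" by (rule W1_E[OF assms(1)])
  obtain d' n' where d': "word n' d'" "y = d' v" by (rule W1_E[OF assms(2)])
  have "word (n + n') (\<lambda>u. scale a (d u) + scale b (d' u))"
    by (intro word_add word_scale word_mono[OF d(1)] word_mono[OF d'(1)]) simp_all
  from W1_I[OF this] show ?thesis by (simp add: d d')
qed

lemma subspaceI_lin:
  assumes "x \<in> S" "\<And>a b x y. x \<in> S \<Longrightarrow> y \<in> S \<Longrightarrow> scale a x + scale b y \<in> S"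
  shows "subspace S"
  unfolding subspace_def
proof (intro conjI ballI allI)
  show "0 \<in> S" using assms(2)[OF assms(1,1), of 0 0] by simp
  show "x + y \<in> S" if "x \<in> S" "y \<in> S" for x y using assms(2)[OF that, of 1 1] by simp
  show "scale a x \<in> S" if "x \<in> S" for a x using assms(2)[OF that that, of a 0] by simp
qed

lemma subspace_W1: "subspace W1"
  by (rule subspaceI_lin[OF W1_v W1_lin])

lemma subspace_W2: "subspace W2"
  by (rule subspaceI_lin[OF W2_v W2_lin])

text \<open>Words commute with \<open>R\<close>, and \<open>W2\<close> arises from \<open>v\<close>
  by applying \<open>R\<close>; so a word is determined on \<open>W2\<close> by its value at
  \<open>v\<close>. This makes \<open>tau\<close> well defined.\<close>

lemma word_cong_W2:
  assumes d: "word n d" and d': "word m d'" and eq: "d v = d' v"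
  shows "y \<in> W2 \<Longrightarrow> d y = d' y"
proof (induction rule: W2.induct)
  case W2_v show ?case by (rule eq)
next
  case (W2_lin u w a b) then show ?case by (simp add: word_lin[OF d] word_lin[OF d'])
next
  case (W2_R u X) then show ?case by (simp add: word_R[OF _ d] word_R[OF _ d'])
qed

lemma E_eigen_W2:
  assumes A: "fin A" and eq: "E A v = scale a v"
  shows "y \<in> W2 \<Longrightarrow> E A y = scale a y"
proof (induction rule: W2.induct)
  case W2_v show ?case by (rule eq)
next
  case (W2_lin u w b b') then show ?case
    by (simp add: E_add[OF A] E_scale[OF A] scale_right_distrib mult.commute)
next
  case (W2_R u X) then show ?case by (simp add: E_R_commute[OF A] R_scale)
qed

text \<open>Matrix units that raise are moved to the right-hand argument of the form, where they become
  lowering; the others are commuted to the far right, where they act by scalars. Either way the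
  word gets shorter.\<close>

lemma word_factor:
  "word n d \<Longrightarrow> w \<in> W2 \<Longrightarrow> w' \<in> W2 \<Longrightarrow> form (d w) w' = form (d v) v * form w w'"
proof (induction n arbitrary: d w w')
  \<comment> \<open>With both vectors quantified, the property is closed under linear combinations
    of words, which is how commutator terms are recombined.\<close>
  define Q where "Q d \<longleftrightarrow> (\<forall>w\<in>W2. \<forall>w'\<in>W2. form (d w) w' = form (d v) v * form w w')" for d
  have Q_scal: "Q (scale a)" for a
    unfolding Q_def by (simp add: form_scale_left norm_v)
  have Q_add: "Q (\<lambda>u. d u + d' u)" if "Q d" "Q d'" for d d'
    using that unfolding Q_def by (simp add: form_add_left distrib_right)
  have Q_lin: "Q (\<lambda>u. scale a (d u) + scale b (d' u))" if "Q d" "Q d'" for a b d d'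
    using that unfolding Q_def by (simp add: form_add_left form_scale_left distrib_right)
  have base: "word k d \<Longrightarrow> k = 0 \<Longrightarrow> Q d" for k d
    by (induction rule: word.induct) (simp_all add: Q_scal Q_add)
  {
    case 0
    then show ?case using base unfolding Q_def by blast
  next
    case (Suc n)
    have IH: "Q d" if "word n d" for d
      using Suc(1)[OF that] unfolding Q_def by blast
    have step: "Q (\<lambda>u. E A (d u))" if d: "word n d" and A: "fin A" for d A
      using A
    proof (induction rule: fin_mat_induct)
      case zero
      show ?case unfolding Q_def by (simp add: E_zero_mat)
    next
      case (unit x y)
      note fin = fin_mat_unit[OF unit(2,3)] and fin' = fin_mat_unit[OF unit(3,2)]
      show ?case
      proof (cases "seq_gt (key y) (key x)")
        case True
        have "E (unit_mat y x) v = scale 0 v" using E_lower_v[OF unit(3,2) True] by simp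
        then have "E (unit_mat y x) w = 0" if "w \<in> W2" for w
          using E_eigen_W2[OF fin' _ that, of 0] by simp
        then show ?thesis unfolding Q_def by (simp add: E_adj[OF fin] madj_unit W2_v)
      next
        case False
        then have "seq_gt (key x) (key y) \<or> x = y" using seq_gt_total key_inj by blast
        then have "E (unit_mat x y) v = scale (if x = y then wt x - c else 0) v"
          using E_lower_v[OF unit(2,3)] E_diag_v[OF unit(2)] by (cases "x = y") simp_all
        then obtain a where av: "E (unit_mat x y) v = scale a v" ..
        have a: "E (unit_mat x y) w = scale a w" if "w \<in> W2" for w
          by (rule E_eigen_W2[OF fin av that])
        obtain d' where d': "word n d'" "\<forall>u. E (unit_mat x y) (d u) = d (E (unit_mat x y) u) + d' u"
          using word_commutator[OF fin d] by (elim exE conjE)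
        have "E (unit_mat x y) (d w) = scale a (d w) + scale 1 (d' w)" if "w \<in> W2" for w
          using d'(2) by (simp add: a[OF that] word_scale_arg[OF d])
        note eq = this
        have Q': "Q (\<lambda>u. scale a (d u) + scale 1 (d' u))" by (rule Q_lin[OF IH[OF d] IH[OF d'(1)]])
        show ?thesis unfolding Q_def
        proof (intro ballI)
          fix w w' assume w: "w \<in> W2" and w': "w' \<in> W2"
          show "form (E (unit_mat x y) (d w)) w' = form (E (unit_mat x y) (d v)) v * form w w'"
            unfolding eq[OF w] eq[OF W2_v] by (rule Q'[unfolded Q_def, rule_format, OF w w'])
        qed
      qed
    next
      case (oplin a b B C)
      show ?case using Q_lin[OF oplin(3,4), of a b] by (simp add: E_oplin[OF oplin(1,2)])
    qed
    have "word k d \<Longrightarrow> k = Suc n \<Longrightarrow> Q d" for k d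
    proof (induction rule: word.induct)
      case (word_scal k a) show ?case by (rule Q_scal)
    next
      case (word_step k d A)
      then have "word n d" by simp
      then show ?case by (rule step[OF _ word_step(2)])
    next
      case (word_add k d d')
      then show ?case by (intro Q_add) simp_all
    next
      case (word_Suc k d)
      then show ?case by (intro IH) simp
    qed
    then show ?case using Suc(2-) unfolding Q_def by blast
  }
qed

text \<open>Moving \<open>d'\<close> to the left as its adjoint word \<open>e\<close> gives a single
  word, to which \<open>word_factor\<close> applies; at \<open>v\<close> the same move is
  undone.\<close>

lemma form_words:
  assumes d: "word n d" and d': "word m d'" and w: "w \<in> W2" and w': "w' \<in> W2"
  shows "form (d w) (d' w') = form (d v) (d' v) * form w w'"
proof -
  obtain e where e: "word m e" "\<And>u z. form (d' u) z = form u (e z)" using word_adj[OF d'] by blast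
  have swap: "form (d u) (d' z) = form (e (d u)) z" for u z
    by (subst form_herm) (simp add: e(2), subst form_herm, simp)
  show ?thesis unfolding swap using word_factor[OF word_comp[OF d e(1)] w w'] .
qed

section \<open>The tensor map\<close>

definition tau :: "'v \<Rightarrow> 'v \<Rightarrow> 'v" where
  "tau x = (SOME d. (\<exists>n. word n d) \<and> d v = x)"

lemma tau_word:
  assumes "word n d" "y \<in> W2"
  shows "tau (d v) y = d y"
proof -
  have "\<exists>d'. (\<exists>n. word n d') \<and> d' v = d v" using assms by blast
  from someI_ex[OF this] obtain m where m: "word m (tau (d v))" "tau (d v) v = d v"
    unfolding tau_def by blast
  show ?thesis by (rule word_cong_W2[OF m(1) assms(1) m(2) assms(2)])
qed

lemma tau_ex_word:
  assumes "x \<in> W1"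
  obtains n d where "word n d" "x = d v" "\<forall>y\<in>W2. tau x y = d y"
proof -
  obtain d n where d: "word n d" "x = d v" by (rule W1_E[OF assms])
  then show ?thesis using that[OF d] tau_word[OF d(1)] by blast
qed

lemma tau_v_right: "x \<in> W1 \<Longrightarrow> tau x v = x"
  using tau_ex_word[of x] W2_v by metis

lemma tau_v_left: "y \<in> W2 \<Longrightarrow> tau v y = y"
  using tau_word[OF word_scal[of 0 1], of y] by simp

lemma tau_lin_left:
  assumes "x \<in> W1" "x' \<in> W1" "y \<in> W2"
  shows "tau (scale a x + scale b x') y = scale a (tau x y) + scale b (tau x' y)"
proof -
  obtain d n where d: "word n d" "x = d v" "\<forall>y\<in>W2. tau x y = d y" by (rule tau_ex_word[OF assms(1)])
  obtain d' n' where d': "word n' d'" "x' = d' v" "\<forall>y\<in>W2. tau x' y = d' y" by (rule tau_ex_word[OF assms(2)])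
  have "word (n + n') (\<lambda>u. scale a (d u) + scale b (d' u))"
    by (intro word_add word_scale word_mono[OF d(1)] word_mono[OF d'(1)]) simp_all
  from tau_word[OF this assms(3)] show ?thesis using d(2) d'(2) d(3)[rule_format, OF assms(3)] d'(3)[rule_format, OF assms(3)] by simp
qed

lemma tau_lin_right:
  assumes "x \<in> W1" "y \<in> W2" "y' \<in> W2"
  shows "tau x (scale a y + scale b y') = scale a (tau x y) + scale b (tau x y')"
proof -
  obtain d n where d: "word n d" "x = d v" "\<forall>y\<in>W2. tau x y = d y" by (rule tau_ex_word[OF assms(1)])
  show ?thesis using d(3)[rule_format, OF assms(2)] d(3)[rule_format, OF assms(3)] d(3)[rule_format, OF W2_lin[OF assms(2,3)]] word_lin[OF d(1)] by simp
qed

lemma form_tau: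
  assumes "x \<in> W1" "x' \<in> W1" "y \<in> W2" "y' \<in> W2"
  shows "form (tau x y) (tau x' y') = form x x' * form y y'"
proof -
  obtain d n where d: "word n d" "x = d v" "\<forall>y\<in>W2. tau x y = d y" by (rule tau_ex_word[OF assms(1)])
  obtain d' n' where d': "word n' d'" "x' = d' v" "\<forall>y\<in>W2. tau x' y = d' y" by (rule tau_ex_word[OF assms(2)])
  show ?thesis using form_words[OF d(1) d'(1) assms(3,4)] d(2) d'(2) d(3)[rule_format, OF assms(3)] d'(3)[rule_format, OF assms(4)] by simp
qed

text \<open>With one set \<open>F\<close> carrying both \<open>d v\<close> and \<open>d y\<close>,
  \<open>D X\<close> acts on both as the same truncation, hence prolongs the word \<open>d\<close>
  by one factor.\<close>

lemma tau_D:
  assumes X: "rc X" and x: "x \<in> W1" and y: "y \<in> W2"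
  shows "D X x \<in> W1" "D X (tau x y) = tau (D X x) y"
proof -
  obtain d n where d: "word n d" "x = d v" "\<forall>y\<in>W2. tau x y = d y" by (rule tau_ex_word[OF x])
  obtain F where F: "finite F" "\<And>z. z \<in> {d v, d y} \<Longrightarrow> carries F z"
    using ex_common_carrier[of "{d v, d y}"] by blast
  have c: "carries F (d v)" "carries F (d y)" using F(2) by blast+
  have "word (Suc n) (\<lambda>u. E (mrestr X F) (d u))"
    by (rule word_step[OF d(1) fin_mat_mrestr[OF X F(1)]])
  note w = W1_I[OF this] tau_word[OF this y]
  show "D X x \<in> W1" using w(1) by (simp add: d(2) D_eq[OF X F(1) c(1)])
  show "D X (tau x y) = tau (D X x) y"
    unfolding d(3)[rule_format, OF y] using w(2) by (simp add: d(2) D_eq[OF X F(1) c(1)] D_eq[OF X F(1) c(2)])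
qed

lemma tau_R:
  assumes X: "X \<in> G" and x: "x \<in> W1" and y: "y \<in> W2"
  shows "R X (tau x y) = tau x (R X y)"
proof -
  obtain d n where d: "word n d" "x = d v" "\<forall>y\<in>W2. tau x y = d y" by (rule tau_ex_word[OF x])
  show ?thesis unfolding d(3)[rule_format, OF y] d(3)[rule_format, OF W2_R[OF y X]] word_R[OF X d(1)] ..
qed

lemma tau_rho:
  assumes X: "X \<in> G" and x: "x \<in> W1" and y: "y \<in> W2"
  shows "rho X (tau x y) = tau (D X x) y + tau x (R X y)"
  using tau_D(2)[OF rc_mat_Ghat[OF X] x y] tau_R[OF X x y] R_def[of X "tau x y"] by (simp add: diff_eq_eq add.commute)

subsection \<open>The tensor decomposition\<close>

lemma is_rep_W1: "is_rep L LF scale D W1"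
  unfolding is_rep_def
proof (intro conjI ballI allI)
  show "subspace W1" by (rule subspace_W1)
  fix X Y u u' a b assume X: "X \<in> G" and u: "u \<in> W1"
  note rcX = rc_mat_Ghat[OF X]
  show "D X u \<in> W1" by (rule tau_D(1)[OF rcX u W2_v])
  show "D X (scale a u + scale b u') = scale a (D X u) + scale b (D X u')" by (rule D_lin[OF rcX])
  assume "Y \<in> G"
  note rcY = rc_mat_Ghat[OF this]
  show "D (oplin a X b Y) u = scale a (D X u) + scale b (D Y u)" by (rule D_oplin[OF rcX rcY])
  show "D (opcomm X Y) u = D X (D Y u) - D Y (D X u)" by (rule D_comm[OF rcX rcY, symmetric])
qed

lemma is_rep_W2: "is_rep L LF scale R W2"
  unfolding is_rep_def
proof (intro conjI ballI allI)
  show "subspace W2" by (rule subspace_W2)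
  fix X Y u u' a b assume X: "X \<in> G" and u: "u \<in> W2"
  show "R X u \<in> W2" by (rule W2_R[OF u X])
  show "R X (scale a u + scale b u') = scale a (R X u) + scale b (R X u')"
    by (simp add: R_add[OF X] R_scale[OF X])
  assume Y: "Y \<in> G"
  show "R (oplin a X b Y) u = scale a (R X u) + scale b (R Y u)" by (rule R_oplin[OF X Y])
  show "R (opcomm X Y) u = R X (R Y u) - R Y (R X u)" by (rule R_comm[OF X Y])
qed

lemma unitary_W1: "unitary_rep L LF scale D W1"
  unfolding unitary_rep_def using form_lin form_herm form_pos D_adj
  by (intro exI[of _ form] conjI ballI allI impI)

lemma unitary_W2: "unitary_rep L LF scale R W2"
  unfolding unitary_rep_def using form_lin form_herm form_pos R_adj
  by (intro exI[of _ form] conjI ballI allI impI)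

text \<open>\<open>D\<close> agrees with \<open>E\<close> on finitary matrices, so an invariant
  subspace containing \<open>v\<close> contains every word applied to \<open>v\<close>.\<close>

lemma generates_W1:
  assumes "U \<subseteq> W1" "v \<in> U" "invariant_subspace L LF scale D U"
  shows "U = W1"
proof
  have sub: "subspace U" and inv: "\<And>X u. X \<in> G \<Longrightarrow> u \<in> U \<Longrightarrow> D X u \<in> U"
    using assms(3) unfolding invariant_subspace_def by blast+
  have "word n d \<Longrightarrow> d v \<in> U" for n d
  proof (induction rule: word.induct)
    case (word_scal n a) show ?case by (rule subspace_scale[OF sub assms(2)])
  next
    case (word_step n d A) then show ?case
      using inv[OF fin_mat_Ghat[OF word_step(2)], of "d v"] by (simp add: D_fin)
  next
    case (word_add n d d') then show ?case using subspace_add[OF sub] by blast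
  qed
  then show "W1 \<subseteq> U" unfolding W1_def by blast
qed (rule assms(1))

lemma generates_W2:
  assumes "U \<subseteq> W2" "v \<in> U" "invariant_subspace L LF scale R U"
  shows "U = W2"
proof
  have sub: "subspace U" and inv: "\<And>X u. X \<in> G \<Longrightarrow> u \<in> U \<Longrightarrow> R X u \<in> U"
    using assms(3) unfolding invariant_subspace_def by blast+
  have "y \<in> U" if "y \<in> W2" for y
    using that
  proof (induction rule: W2.induct)
    case W2_v show ?case by (rule assms(2))
  next
    case (W2_lin u w a b) then show ?case by (intro subspace_add[OF sub] subspace_scale[OF sub])
  next
    case (W2_R u X) then show ?case using inv by blast
  qed
  then show "W2 \<subseteq> U" by blast
qed (rule assms(1))

lemma lowest_weight_W1: "lowest_weight_rep L LF scale D W1 h1 v"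
  unfolding lowest_weight_rep_def
  using h1_functional W1_v v_nonzero D_Gminus_v D_G00_v generates_W1 by blast

lemma lowest_weight_W2: "lowest_weight_rep L LF scale R W2 (\<lambda>H. h H - h1 H) v"
  unfolding lowest_weight_rep_def
  using h2_functional W2_v v_nonzero R_Gminus_v R_G00_v generates_W2 by blast

text \<open>Stated for submodules of both factors, since it serves the spanning statement and both
  irreducibility proofs.\<close>

lemma span_tau_invariant:
  assumes "U1 \<subseteq> W1" "U2 \<subseteq> W2"
    and "\<And>X x. X \<in> G \<Longrightarrow> x \<in> U1 \<Longrightarrow> D X x \<in> U1" "\<And>X y. X \<in> G \<Longrightarrow> y \<in> U2 \<Longrightarrow> R X y \<in> U2"
  shows "invariant_subspace L LF scale rho (span {tau x y | x y. x \<in> U1 \<and> y \<in> U2})"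
    (is "invariant_subspace L LF scale rho (span ?T)")
  unfolding invariant_subspace_def
proof (intro conjI ballI)
  show "subspace (span ?T)" by (rule subspace_span)
  fix X u assume X: "X \<in> G" and u: "u \<in> span ?T"
  from u show "rho X u \<in> span ?T"
  proof (induction rule: span_induct_alt)
    case base
    show ?case using rho_zero[OF X] span_zero by simp
  next
    case (step a t u)
    then obtain x y where t: "t = tau x y" "x \<in> U1" "y \<in> U2" by blast
    have "rho X t = tau (D X x) y + tau x (R X y)"
      unfolding t(1) using t assms(1,2) by (intro tau_rho[OF X]) blast+
    moreover have "tau (D X x) y \<in> ?T" "tau x (R X y) \<in> ?T" using t assms(3,4) X by blast+
    ultimately have "rho X t \<in> span ?T" using span_add span_base by simp
    then show ?case using step
      by (simp add: rho_add[OF X] rho_scale[OF X] span_add span_scale)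
  qed
qed

lemma form_eq_W1: "w \<in> W1 \<Longrightarrow> w' \<in> W1 \<Longrightarrow> (\<And>z. z \<in> W1 \<Longrightarrow> form w z = form w' z) \<Longrightarrow> w = w'"
  using form_self_zero[of "w - w'"] subspace_diff[OF subspace_W1, of w w'] by (simp add: form_diff_left)

lemma form_eq_W2: "w \<in> W2 \<Longrightarrow> w' \<in> W2 \<Longrightarrow> (\<And>z. z \<in> W2 \<Longrightarrow> form w z = form w' z) \<Longrightarrow> w = w'"
  using form_self_zero[of "w - w'"] subspace_diff[OF subspace_W2, of w w'] by (simp add: form_diff_left)

lemma span_tau: "span {tau x y | x y. x \<in> W1 \<and> y \<in> W2} = UNIV"
proof (rule lw_generates)
  have "tau v v = v" by (rule tau_v_left[OF W2_v])
  then show "v \<in> span {tau x y | x y. x \<in> W1 \<and> y \<in> W2}"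
    using W1_v W2_v by (intro span_base) (metis (mono_tags, lifting) mem_Collect_eq)
  show "invariant_subspace L LF scale rho (span {tau x y | x y. x \<in> W1 \<and> y \<in> W2})"
    by (rule span_tau_invariant) (use tau_D(1)[OF rc_mat_Ghat _ W2_v] W2_R in blast)+
qed

text \<open>Pairing the relation with \<open>tau z y\<close> factorises: the combination of the
  \<open>x\<close> with coefficients \<open>form (f x) y\<close> is orthogonal to all
  \<open>z\<close> in \<open>W1\<close>, hence 0. Independence kills the coefficients, and
  \<open>y\<close> was arbitrary in \<open>W2\<close>.\<close>

lemma tau_injective:
  assumes S: "finite S" "S \<subseteq> W1" "\<not> dependent S" and f: "f ` S \<subseteq> W2"
    and zero: "(\<Sum>x\<in>S. tau x (f x)) = 0" and x: "x \<in> S"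
  shows "f x = 0"
proof -
  have fW: "f x \<in> W2" if "x \<in> S" for x using f that by blast
  have SW: "x \<in> W1" if "x \<in> S" for x using S(2) that by blast
  have "form (f x) y = 0" if y: "y \<in> W2" for y
  proof -
    let ?u = "\<Sum>x\<in>S. scale (form (f x) y) x"
    have u: "?u \<in> W1" using SW by (intro subspace_sum[OF subspace_W1] subspace_scale[OF subspace_W1])
    have "form ?u z = 0" if z: "z \<in> W1" for z
    proof -
      have "form ?u z = (\<Sum>x\<in>S. form (tau x (f x)) (tau z y))"
        unfolding form_sum_left using fW SW y z by (intro sum.cong refl) (simp add: form_scale_left form_tau)
      also have "\<dots> = 0" using zero by (simp flip: form_sum_left)
      finally show ?thesis .
    qed
    then have "?u = 0" using u form_self_zero by blast
    then show ?thesis using S(1,3) x by (metis independentD order_refl)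
  qed
  then show ?thesis using fW[OF x] form_self_zero by blast
qed

lemma tensor_iso_W1_W2: "tensor_iso L LF scale rho W1 D W2 R tau"
  unfolding tensor_iso_def
proof (intro conjI)
  show "\<forall>x\<in>W1. \<forall>x'\<in>W1. \<forall>y\<in>W2. \<forall>a b. tau (scale a x + scale b x') y = scale a (tau x y) + scale b (tau x' y)"
    by (intro ballI allI tau_lin_left)
  show "\<forall>x\<in>W1. \<forall>y\<in>W2. \<forall>y'\<in>W2. \<forall>a b. tau x (scale a y + scale b y') = scale a (tau x y) + scale b (tau x y')"
    by (intro ballI allI tau_lin_right)
  show "span {tau x y | x y. x \<in> W1 \<and> y \<in> W2} = UNIV" by (rule span_tau)
  show "\<forall>S f. finite S \<and> S \<subseteq> W1 \<and> \<not> dependent S \<and> f ` S \<subseteq> W2 \<and> (\<Sum>x\<in>S. tau x (f x)) = 0 \<longrightarrow> (\<forall>x\<in>S. f x = 0)"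
    by (intro allI impI ballI, elim conjE) (rule tau_injective)
  show "\<forall>X\<in>G. \<forall>x\<in>W1. \<forall>y\<in>W2. rho X (tau x y) = tau (D X x) y + tau x (R X y)"
    by (intro ballI tau_rho)
qed

section \<open>Irreducibility of the factors\<close>

lemma irreducible_W1:
  assumes irr: "irreducible_rep L LF scale rho UNIV"
  shows "irreducible_rep L LF scale D W1"
  unfolding irreducible_rep_def
proof (intro conjI allI impI)
  show "W1 \<noteq> {0}" using W1_v v_nonzero by blast
  fix U assume U: "U \<subseteq> W1 \<and> invariant_subspace L LF scale D U"
  then have UW: "U \<subseteq> W1" and sub: "subspace U" and inv: "\<And>X u. X \<in> G \<Longrightarrow> u \<in> U \<Longrightarrow> D X u \<in> U"
    unfolding invariant_subspace_def by blast+
  show "U = {0} \<or> U = W1"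
  proof (rule disjCI)
    assume "U \<noteq> W1"
    show "U = {0}"
    proof (rule ccontr)
      assume "U \<noteq> {0}"
      then obtain u where u: "u \<in> U" "u \<noteq> 0" using subspace_0[OF sub] by blast
      let ?T = "{tau x y | x y. x \<in> U \<and> y \<in> W2}"
      have "invariant_subspace L LF scale rho (span ?T)"
        by (rule span_tau_invariant[OF UW order_refl inv W2_R])
      then have "span ?T = {0} \<or> span ?T = UNIV" using irr unfolding irreducible_rep_def by blast
      moreover have "u \<in> span ?T"
      proof (rule span_base)
        have "u = tau u v" using tau_v_right u UW by auto
        then show "u \<in> ?T" using u(1) W2_v by blast
      qed
      ultimately have T: "span ?T = UNIV" using u(2) by blast
      \<comment> \<open>Partial projection: \<open>z\<close> equals \<open>tau z v\<close>, so
        tested against \<open>W1\<close> the vector \<open>tau x y\<close> looks like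
        \<open>x\<close> scaled by \<open>form y v\<close>, which lies in \<open>U\<close>. Applied
        to elements of \<open>W1\<close> itself it shows \<open>U = W1\<close>.\<close>
      have proj: "\<exists>w\<in>U. \<forall>z\<in>W1. form t z = form w z" if "t \<in> span ?T" for t
        using that
      proof (induction rule: span_induct_alt)
        case base
        show ?case using subspace_0[OF sub] by (intro bexI[of _ 0]) auto
      next
        case (step a s t)
        then obtain x y where s: "s = tau x y" "x \<in> U" "y \<in> W2" by blast
        obtain w where w: "w \<in> U" "\<forall>z\<in>W1. form t z = form w z" using step(2) by blast
        have "form s z = form y v * form x z" if "z \<in> W1" for z
          using form_tau[of x z y v] s UW that W2_v tau_v_right[OF that] by (auto simp: mult.commute)
        then have "\<forall>z\<in>W1. form (scale a s + t) z = form (scale (a * form y v) x + w) z"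
          using w(2) by (simp add: form_add_left form_scale_left)
        moreover have "scale (a * form y v) x + w \<in> U"
          using subspace_add[OF sub subspace_scale[OF sub s(2)] w(1)] by blast
        ultimately show ?case by blast
      qed
      have "w \<in> U" if w: "w \<in> W1" for w
      proof -
        have "w \<in> span ?T" using T by simp
        from proj[OF this] obtain w' where w': "w' \<in> U" "\<forall>z\<in>W1. form w z = form w' z" by blast
        have "w = w'" using w' UW by (intro form_eq_W1[OF w]) blast+
        then show ?thesis using w'(1) by simp
      qed
      then show False using UW \<open>U \<noteq> W1\<close> by blast
    qed
  qed
qed

text \<open>The argument of \<open>irreducible_W1\<close> with the roles exchanged: now
  \<open>z = tau v z\<close>, and \<open>form x v\<close> is the projected coefficient.\<close>

lemma irreducible_W2:
  assumes irr: "irreducible_rep L LF scale rho UNIV"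
  shows "irreducible_rep L LF scale R W2"
  unfolding irreducible_rep_def
proof (intro conjI allI impI)
  show "W2 \<noteq> {0}" using W2_v v_nonzero by blast
  fix U assume U: "U \<subseteq> W2 \<and> invariant_subspace L LF scale R U"
  then have UW: "U \<subseteq> W2" and sub: "subspace U" and inv: "\<And>X u. X \<in> G \<Longrightarrow> u \<in> U \<Longrightarrow> R X u \<in> U"
    unfolding invariant_subspace_def by blast+
  show "U = {0} \<or> U = W2"
  proof (rule disjCI)
    assume "U \<noteq> W2"
    show "U = {0}"
    proof (rule ccontr)
      assume "U \<noteq> {0}"
      then obtain u where u: "u \<in> U" "u \<noteq> 0" using subspace_0[OF sub] by blast
      let ?T = "{tau x y | x y. x \<in> W1 \<and> y \<in> U}"
      have "invariant_subspace L LF scale rho (span ?T)"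
        by (rule span_tau_invariant[OF order_refl UW tau_D(1)[OF rc_mat_Ghat _ W2_v] inv])
      then have "span ?T = {0} \<or> span ?T = UNIV" using irr unfolding irreducible_rep_def by blast
      moreover have "u \<in> span ?T"
      proof (rule span_base)
        have "u = tau v u" using tau_v_left u UW by auto
        then show "u \<in> ?T" using u(1) W1_v by blast
      qed
      ultimately have T: "span ?T = UNIV" using u(2) by blast
      have proj: "\<exists>w\<in>U. \<forall>z\<in>W2. form t z = form w z" if "t \<in> span ?T" for t
        using that
      proof (induction rule: span_induct_alt)
        case base
        show ?case using subspace_0[OF sub] by (intro bexI[of _ 0]) auto
      next
        case (step a s t)
        then obtain x y where s: "s = tau x y" "x \<in> W1" "y \<in> U" by blast
        obtain w where w: "w \<in> U" "\<forall>z\<in>W2. form t z = form w z" using step(2) by blast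
        have "form s z = form x v * form y z" if "z \<in> W2" for z
          using form_tau[of x v y z] s UW that W1_v tau_v_left[OF that] by auto
        then have "\<forall>z\<in>W2. form (scale a s + t) z = form (scale (a * form x v) y + w) z"
          using w(2) by (simp add: form_add_left form_scale_left)
        moreover have "scale (a * form x v) y + w \<in> U"
          using subspace_add[OF sub subspace_scale[OF sub s(3)] w(1)] by blast
        ultimately show ?case by blast
      qed
      have "w \<in> U" if w: "w \<in> W2" for w
      proof -
        have "w \<in> span ?T" using T by simp
        from proj[OF this] obtain w' where w': "w' \<in> U" "\<forall>z\<in>W2. form w z = form w' z" by blast
        have "w = w'" using w' UW by (intro form_eq_W2[OF w]) blast+
        then show ?thesis using w'(1) by simp
      qed
      then show False using UW \<open>U \<noteq> W2\<close> by blast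
    qed
  qed
qed

section \<open>Approximate finiteness of the first weight\<close>

lemma h1_unit:
  assumes "ok x"
  shows "h1 (unit_mat x x) = wt x - c"
  using D_G00_v[OF unit_mat_G00[OF assms]] D_fin[OF fin_mat_unit[OF assms assms]] E_diag_v[OF assms] v_nonzero
  by simp

lemma hI_h1: "ok (l1, I, l2) \<Longrightarrow> hI L LF h1 l1 I l2 = wt (l1, I, l2) - c"
  using h1_unit[of "(l1, I, l2)"] opm_of_unit_gen[of L LF "(l1, I, l2)" "(l1, I, l2)"] by (simp add: hI_def)

text \<open>If the diagonal entry of \<open>H\<close> at \<open>x\<close> counts the parameters
  \<open>s\<close> lying over \<open>x\<close>, then the weighted diagonal sum \<open>h1 H\<close>
  regroups into a sum over parameters. Fibres and \<open>supp0\<close> are finite, hence so is the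
  set of nonzero terms.\<close>

lemma h1_eq_sum_fibres:
  assumes \<phi>: "\<And>s. s \<in> V \<Longrightarrow> ok (\<phi> s)"
    and fin: "\<And>x. ok x \<Longrightarrow> finite {s \<in> V. \<phi> s = x}"
    and card: "\<And>x. ok x \<Longrightarrow> H x x = of_nat (card {s \<in> V. \<phi> s = x})"
  shows "finite {s \<in> V. wt (\<phi> s) - c \<noteq> 0}"
    and "h1 H = (\<Sum>s\<in>{s \<in> V. wt (\<phi> s) - c \<noteq> 0}. wt (\<phi> s) - c)"
proof -
  let ?S = "{s \<in> V. wt (\<phi> s) - c \<noteq> 0}"
  have "?S = (\<Union>x\<in>supp0. {s \<in> V. \<phi> s = x})" using \<phi> by (auto simp: supp0_def)
  moreover have "finite (\<Union>x\<in>supp0. {s \<in> V. \<phi> s = x})"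
    using finite_supp0 fin by (intro finite_UN_I) (simp_all add: supp0_def)
  ultimately show finS: "finite ?S" by (simp only:)
  have "(\<Sum>s\<in>?S. wt (\<phi> s) - c) = (\<Sum>x\<in>supp0. \<Sum>s\<in>{s \<in> ?S. \<phi> s = x}. wt (\<phi> s) - c)"
    using \<phi> by (intro sum.group[symmetric] finS finite_supp0) (auto simp: supp0_def)
  also have "\<dots> = (\<Sum>x\<in>supp0. H x x * (wt x - c))"
  proof (intro sum.cong refl)
    fix x assume x: "x \<in> supp0"
    then have okx: "ok x" and "wt x \<noteq> c" by (simp_all add: supp0_def)
    then have "{s \<in> ?S. \<phi> s = x} = {s \<in> V. \<phi> s = x}" by auto
    then show "(\<Sum>s\<in>{s \<in> ?S. \<phi> s = x}. wt (\<phi> s) - c) = H x x * (wt x - c)"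
      by (simp add: card[OF okx])
  qed
  finally show "h1 H = (\<Sum>s\<in>?S. wt (\<phi> s) - c)" by (simp add: h1_def)
qed

text \<open>In differences of \<open>hI\<close> values \<open>c\<close> cancels, leaving
  \<open>wt_diff_nat\<close>. For the other three kinds the parameters are the paddings of
  \<open>I\<close> to a full basis vector, and the fibres are the factorisations counted by the
  matrix entries.\<close>

lemma approx_finite_h1: "approx_finite L LF h1"
proof -
  have "\<exists>n::nat. hI L LF h1 l1 I l2 - hI L LF h1 l3 J l4 = of_nat n"
    if "ok (l1, I, l2)" "ok (l3, J, l4)" "seq_gt (J @ [l3, l4]) (I @ [l1, l2])" for l1 l2 l3 l4 I J
    using wt_diff_nat[OF that(1,2)] that by (simp add: hI_h1)
  then have i: "\<forall>l1 l2 l3 l4 I J. valid_lam LF l1 \<and> valid_lam LF l2 \<and> valid_lam LF l3 \<and> valid_lam LF l4 \<and>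
         valid_seq L I \<and> valid_seq L J \<and> seq_gt (J @ [l3, l4]) (I @ [l1, l2]) \<longrightarrow>
         (\<exists>n::nat. hI L LF h1 l1 I l2 - hI L LF h1 l3 J l4 = of_nat n)"
    by (simp add: basis_ok_def)
  have ii: "finite {(I1, l1). valid_seq L I1 \<and> valid_lam LF l1 \<and> hI L LF h1 l (I @ I1) l1 \<noteq> 0} \<and>
      hII L LF h1 l I = (\<Sum>(I1, l1)\<in>{(I1, l1). valid_seq L I1 \<and> valid_lam LF l1 \<and> hI L LF h1 l (I @ I1) l1 \<noteq> 0}.
          hI L LF h1 l (I @ I1) l1)" (is "finite ?S \<and> _")
    if l: "valid_lam LF l" and I: "valid_seq L I" for l I
  proof -
    define V where "V = {(I1, l1). valid_seq L I1 \<and> valid_lam LF l1}"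
    define \<phi> where "\<phi> = (\<lambda>(I1, l1). (l, I @ I1, l1 :: nat))"
    have ok\<phi>: "ok (\<phi> s)" if "s \<in> V" for s
      using that l I by (auto simp: V_def \<phi>_def basis_ok_def)
    have S: "?S = {s \<in> V. wt (\<phi> s) - c \<noteq> 0}"
      using l I by (intro set_eqI) (simp add: V_def \<phi>_def hI_h1 basis_ok_def split: prod.split cong: conj_cong)
    \<comment> \<open>Admissibility of \<open>(a, K, b)\<close> supplies the validity of
      \<open>Q\<close> and \<open>b\<close> that membership in \<open>V\<close> demands.\<close>
    have fibre: "bij_betw (\<lambda>Q. (Q, b)) {Q. a = l \<and> K = I @ Q} {s \<in> V. \<phi> s = (a, K, b)}" if "ok (a, K, b)" for a K b
      by (rule bij_betw_byWitness[where f' = fst]) (use that in \<open>auto simp: V_def \<phi>_def basis_ok_def\<close>)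
    have fin: "finite {s \<in> V. \<phi> s = x}" if "ok x" for x
    proof -
      obtain a K b where x: "x = (a, K, b)" by (cases x)
      have "finite {Q. a = l \<and> K = I @ Q}" by (rule finite_subset[of _ "{drop (length I) K}"]) auto
      then show ?thesis using bij_betw_finite[OF fibre] that unfolding x by blast
    qed
    have card: "opm_of L LF (Gl l l I I) x x = of_nat (card {s \<in> V. \<phi> s = x})" if "ok x" for x
    proof -
      obtain a K b where x: "x = (a, K, b)" by (cases x)
      show ?thesis using that bij_betw_same_card[OF fibre, of a K b] unfolding x by (auto simp: opm_of_Gl)
    qed
    note sums = h1_eq_sum_fibres[of V \<phi> "opm_of L LF (Gl l l I I)", OF ok\<phi> fin card]
    have "(\<Sum>(I1, l1)\<in>?S. hI L LF h1 l (I @ I1) l1) = (\<Sum>s\<in>?S. wt (\<phi> s) - c)"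
      using l I by (intro sum.cong refl) (auto simp: \<phi>_def hI_h1 basis_ok_def)
    then show ?thesis using sums unfolding S hII_def by simp
  qed
  have iii: "finite {(l1, I1). valid_lam LF l1 \<and> valid_seq L I1 \<and> hI L LF h1 l1 (I1 @ I) l \<noteq> 0} \<and>
      hIII L LF h1 I l = (\<Sum>(l1, I1)\<in>{(l1, I1). valid_lam LF l1 \<and> valid_seq L I1 \<and> hI L LF h1 l1 (I1 @ I) l \<noteq> 0}.
          hI L LF h1 l1 (I1 @ I) l)" (is "finite ?S \<and> _")
    if l: "valid_lam LF l" and I: "valid_seq L I" for l I
  proof -
    define V where "V = {(l1, I1). valid_lam LF l1 \<and> valid_seq L I1}"
    define \<phi> where "\<phi> = (\<lambda>(l1 :: nat, I1). (l1, I1 @ I, l))"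
    have ok\<phi>: "ok (\<phi> s)" if "s \<in> V" for s
      using that l I by (auto simp: V_def \<phi>_def basis_ok_def)
    have S: "?S = {s \<in> V. wt (\<phi> s) - c \<noteq> 0}"
      using l I by (intro set_eqI) (simp add: V_def \<phi>_def hI_h1 basis_ok_def split: prod.split cong: conj_cong)
    have fibre: "bij_betw (\<lambda>P. (a, P)) {P. b = l \<and> K = P @ I} {s \<in> V. \<phi> s = (a, K, b)}" if "ok (a, K, b)" for a K b
      by (rule bij_betw_byWitness[where f' = snd]) (use that in \<open>auto simp: V_def \<phi>_def basis_ok_def\<close>)
    have fin: "finite {s \<in> V. \<phi> s = x}" if "ok x" for x
    proof -
      obtain a K b where x: "x = (a, K, b)" by (cases x)
      have "finite {P. b = l \<and> K = P @ I}" by (rule finite_subset[of _ "{take (length K - length I) K}"]) auto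
      then show ?thesis using bij_betw_finite[OF fibre] that unfolding x by blast
    qed
    have card: "opm_of L LF (Gr I I l l) x x = of_nat (card {s \<in> V. \<phi> s = x})" if "ok x" for x
    proof -
      obtain a K b where x: "x = (a, K, b)" by (cases x)
      show ?thesis using that bij_betw_same_card[OF fibre, of a K b] unfolding x by (auto simp: opm_of_Gr)
    qed
    note sums = h1_eq_sum_fibres[of V \<phi> "opm_of L LF (Gr I I l l)", OF ok\<phi> fin card]
    have "(\<Sum>(l1, I1)\<in>?S. hI L LF h1 l1 (I1 @ I) l) = (\<Sum>s\<in>?S. wt (\<phi> s) - c)"
      using l I by (intro sum.cong refl) (auto simp: \<phi>_def hI_h1 basis_ok_def)
    then show ?thesis using sums unfolding S hIII_def by simp
  qed
  have iv: "finite {(l1, I1, I2, l2). valid_lam LF l1 \<and> valid_seq L I1 \<and> valid_seq L I2 \<and> valid_lam LF l2 \<and>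
                    hI L LF h1 l1 (I1 @ I @ I2) l2 \<noteq> 0} \<and>
      hIV L LF h1 I = (\<Sum>(l1, I1, I2, l2)\<in>{(l1, I1, I2, l2). valid_lam LF l1 \<and> valid_seq L I1 \<and> valid_seq L I2 \<and> valid_lam LF l2 \<and>
                    hI L LF h1 l1 (I1 @ I @ I2) l2 \<noteq> 0}. hI L LF h1 l1 (I1 @ I @ I2) l2)" (is "finite ?S \<and> _")
    if I: "valid_seq L I" for I
  proof -
    define V where "V = {(l1, I1, I2, l2). valid_lam LF l1 \<and> valid_seq L I1 \<and> valid_seq L I2 \<and> valid_lam LF l2}"
    define \<phi> where "\<phi> = (\<lambda>(l1 :: nat, I1, I2, l2 :: nat). (l1, I1 @ I @ I2, l2))"
    have ok\<phi>: "ok (\<phi> s)" if "s \<in> V" for s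
      using that I by (auto simp: V_def \<phi>_def basis_ok_def)
    have S: "?S = {s \<in> V. wt (\<phi> s) - c \<noteq> 0}"
      using I by (intro set_eqI) (simp add: V_def \<phi>_def hI_h1 basis_ok_def split: prod.split cong: conj_cong)
    have fibre: "bij_betw (\<lambda>(P, Q). (a, P, Q, b)) {(P, Q). K = P @ I @ Q} {s \<in> V. \<phi> s = (a, K, b)}"
      if "ok (a, K, b)" for a K b
      by (rule bij_betw_byWitness[where f' = "\<lambda>(l1, P, Q, l2). (P, Q)"])
        (use that in \<open>auto simp: V_def \<phi>_def basis_ok_def\<close>)
    have fin: "finite {s \<in> V. \<phi> s = x}" if "ok x" for x
    proof -
      obtain a K b where x: "x = (a, K, b)" by (cases x)
      let ?split = "\<lambda>(i, j). (take i K, drop j K)"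
      have "{(P, Q). K = P @ I @ Q} \<subseteq> ?split ` ({..length K} \<times> {..length K})"
      proof (rule subrelI)
        fix P Q assume "(P, Q) \<in> {(P, Q). K = P @ I @ Q}"
        then have "(P, Q) = ?split (length P, length (P @ I))" "length P \<le> length K" "length (P @ I) \<le> length K" by simp_all
        then show "(P, Q) \<in> ?split ` ({..length K} \<times> {..length K})" by blast
      qed
      then have "finite {(P, Q). K = P @ I @ Q}" by (rule finite_subset) simp
      then show ?thesis using bij_betw_finite[OF fibre] that unfolding x by blast
    qed
    have card: "opm_of L LF (Gs I I) x x = of_nat (card {s \<in> V. \<phi> s = x})" if "ok x" for x
    proof -
      obtain a K b where x: "x = (a, K, b)" by (cases x)
      show ?thesis using that bij_betw_same_card[OF fibre, of a K b] unfolding x by (simp add: opm_of_Gs)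
    qed
    note sums = h1_eq_sum_fibres[of V \<phi> "opm_of L LF (Gs I I)", OF ok\<phi> fin card]
    have "(\<Sum>(l1, I1, I2, l2)\<in>?S. hI L LF h1 l1 (I1 @ I @ I2) l2) = (\<Sum>s\<in>?S. wt (\<phi> s) - c)"
      using I by (intro sum.cong refl) (auto simp: \<phi>_def hI_h1 basis_ok_def)
    then show ?thesis using sums unfolding S hIV_def by simp
  qed
  show ?thesis
    unfolding approx_finite_def Let_def using i ii iii iv by (intro conjI allI impI) simp_all
qed

end

theorem theorem2:
  fixes L LF :: nat
    and scale :: "complex \<Rightarrow> 'v::ab_group_add \<Rightarrow> 'v"
    and rho :: "opm \<Rightarrow> 'v \<Rightarrow> 'v"
  assumes "L > 0" and "LF > 0"
    and "vector_space scale"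
    and "is_rep L LF scale rho UNIV"
    and "unitary_rep L LF scale rho UNIV"
    and "irreducible_rep L LF scale rho UNIV"
    and "\<exists>h v. lowest_weight_rep L LF scale rho UNIV h v"
  shows "\<exists>W1 rho1 W2 rho2 tau.
           is_rep L LF scale rho1 W1 \<and> unitary_rep L LF scale rho1 W1 \<and>
           irreducible_rep L LF scale rho1 W1 \<and>
           (\<exists>h v. lowest_weight_rep L LF scale rho1 W1 h v \<and> approx_finite L LF h) \<and>
           is_rep L LF scale rho2 W2 \<and> unitary_rep L LF scale rho2 W2 \<and>
           irreducible_rep L LF scale rho2 W2 \<and>
           (\<exists>h v. lowest_weight_rep L LF scale rho2 W2 h v) \<and>
           (\<forall>X\<in>sl_inf L LF. \<forall>y\<in>W2. rho2 X y = 0) \<and>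
           tensor_iso L LF scale rho W1 rho1 W2 rho2 tau"
proof -
  obtain h v where lw: "lowest_weight_rep L LF scale rho UNIV h v" using assms(7) by blast
  from assms(5)[unfolded unitary_rep_def] obtain form0 where ex:
    "\<forall>u\<in>UNIV. \<forall>u'\<in>UNIV. \<forall>w\<in>UNIV. \<forall>a b. form0 (scale a u + scale b u') w = a * form0 u w + b * form0 u' w"
    "\<forall>u\<in>UNIV. \<forall>w\<in>UNIV. form0 w u = cnj (form0 u w)"
    "\<forall>u\<in>UNIV. u \<noteq> 0 \<longrightarrow> Re (form0 u u) > 0"
    "\<forall>g. valid_gen L LF g \<longrightarrow> (\<forall>u\<in>UNIV. \<forall>w\<in>UNIV.
       form0 (rho (opm_of L LF g) u) w = form0 u (rho (opm_of L LF (omega_gen g)) w))"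
    by (elim exE conjE)
  note form0 = ex(1)[rule_format, OF UNIV_I UNIV_I UNIV_I] ex(2)[rule_format, OF UNIV_I UNIV_I]
    ex(3)[rule_format, OF UNIV_I] ex(4)[rule_format, OF _ UNIV_I UNIV_I]
  \<comment> \<open>Dividing the given form by the squared norm of \<open>v\<close> yields the
    normalisation assumed in the locale.\<close>
  define N where "N = Re (form0 v v)"
  have "v \<noteq> 0" using lw by (simp add: lowest_weight_rep_def)
  then have N: "N > 0" unfolding N_def by (rule form0(3))
  have vv: "form0 v v = of_real N" using form0(2)[of v v] by (simp add: N_def complex_eq_iff)
  define form where "form u w = form0 u w / of_real N" for u w
  interpret vector_space scale by (rule assms(3))
  interpret unitary_lw_rep scale L LF rho form h v
  proof
    show "L > 0" "LF > 0" "is_rep L LF scale rho UNIV" "lowest_weight_rep L LF scale rho UNIV h v"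
      by (fact assms lw)+
    show "form (scale a u + scale b u') w = a * form u w + b * form u' w" for a b u u' w
      by (simp add: form_def form0(1) add_divide_distrib)
    show "form w u = cnj (form u w)" for u w
      unfolding form_def using form0(2)[of w u] by simp
    show "u \<noteq> 0 \<Longrightarrow> Re (form u u) > 0" for u
      using form0(3)[of u] N by (simp add: form_def)
    show "valid_gen L LF g \<Longrightarrow> form (rho (opm_of L LF g) u) w = form u (rho (opm_of L LF (omega_gen g)) w)" for g u w
      by (simp add: form_def form0(4))
    show "form v v = 1" using N by (simp add: form_def vv)
  qed
  obtain c where c: "c \<in> \<real>" "\<forall>x. ok x \<longrightarrow> (\<exists>n::nat. wt x - c = of_nat n)" "finite {x. ok x \<and> wt x \<noteq> c}"
    by (rule wt_eventually_const)
  interpret shifted_lw_rep scale L LF rho form h v c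
    by unfold_locales (fact c(1), erule c(2)[rule_format], fact c(3))
  have lw1: "\<exists>h v. lowest_weight_rep L LF scale D W1 h v \<and> approx_finite L LF h"
    by (rule exI[of _ h1], rule exI[of _ v], rule conjI[OF lowest_weight_W1 approx_finite_h1])
  have lw2: "\<exists>h v. lowest_weight_rep L LF scale R W2 h v"
    by (rule exI, rule exI, rule lowest_weight_W2)
  show ?thesis
    by (rule exI[of _ W1], rule exI[of _ D], rule exI[of _ W2], rule exI[of _ R], rule exI[of _ tau])
      (intro conjI ballI is_rep_W1 unitary_W1 irreducible_W1[OF assms(6)] lw1
        is_rep_W2 unitary_W2 irreducible_W2[OF assms(6)] lw2 R_sl_inf tensor_iso_W1_W2)
qed

end
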